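(* Let $\lambda$ be a partition with $n$ corners, written $\lambda=(m_1^{r_1}m_2^{r_2-r_1}\cdots m_n^{r_n-r_{n-1}})$ with $m_1>\cdots>m_n>m_{n+1}=0$ and $0<r_1<\cdots<r_n$, and let $1\le d\le n$. (1) Let $\ell=r_d$ (the $d$-th shortest column height of $\lambda$). Then \begin{align*} S^{(r)}_\lambda(X)S^{(r-1)}_\lambda(X)&=S^{(r)}_{\lambda-(1^\ell)}(X)S^{(r-1)}_{\lambda+(1^\ell)}(X)\\ &\quad+\sum_{t=1}^{\min\{d,n-d+1\}}(-1)^{t-1}\sum_{\substack{1\le p_1<\cdots<p_t\le d\\ d\le q_t<\cdots<q_1\le n}}S^{(r)}_{\mathrm{add}^{p_1,\ldots,p_t}_{q_1,\ldots,q_t}(\lambda)}(X)\,S^{(r-1)}_{\mathrm{rem}^{p_1,\ldots,p_t}_{q_1,\ldots,q_t}(\lambda)}(X). \end{align*} (2) Let $\ell$ be the $d$-th shortest row length of $\lambda$. Then \begin{align*} S^{(r)}_\lambda(X)S^{(r+1)}_\lambda(X)&=S^{(r)}_{(\lambda'-(1^\ell))'}(X)S^{(r+1)}_{(\lambda'+(1^\ell))'}(X)\\ &\quad+\sum_{t=1}^{\min\{d,n-d+1\}}(-1)^{t-1}\sum_{\substack{1\le p_1<\cdots<p_t\le d\\ d\le q_t<\cdots<q_1\le n}}S^{(r)}_{(\mathrm{add}^{p_1,\ldots,p_t}_{q_1,\ldots,q_t}(\lambda'))'}(X)\,S^{(r+1)}_{(\mathrm{rem}^{p_1,\ldots,p_t}_{q_1,\ldots,q_t}(\lambda'))'}(X),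 \end{align*} where the operators on $\lambda'$ are defined from the corner data of $\lambda'$.
   Context: Let $N$ be a positive integer and $X=[x_{i,j}]_{1\le i,j\le N}$ a matrix of indeterminates. Over $\mathbb{C}(X)$ write $X=X_-X_0X_+$ (Gauss decomposition). For $0\le r\le N$ and $\lambda\subset((N-r)^r)$, $S^{(r)}_\lambda(X)$ is the minor of $X_+$ with rows $\{1,\ldots,r\}$ and columns $\{\lambda_{r+1-a}+a:1\le a\le r\}$; $N$ is assumed large enough that everything is defined. $\lambda'$ is the conjugate partition. For $a\ge0$, $1\le \ell\le\ell(\lambda)$, $\lambda\pm(a^\ell)$ is obtained by adding/subtracting $a$ to/from the first $\ell$ parts. Young diagram $D(\lambda)=\{(i,j):1\le i\le\ell(\lambda),1\le j\le\lambda_i\}$; a corner is a cell $(i,j)\in D(\lambda)$ with $(i+1,j),(i,j+1)\notin D(\lambda)$; with the notation above the corners are $(r_1,m_1),\ldots,(r_n,m_n)$. The outside border $\mathrm{OB}(\lambda)$ is the set of cells $(i,j)\notin D(\lambda)$, $i,j\ge1$, with $(i-1,j-1)\in D(\lambda)\cup\{(0,j'):0\le j'\le\lambda_1\}\cup\{(i',0):0\le i'\le\ell(\lambda)\}$; the inside border $\mathrm{IB}(\lambda)$ is the set of cells $(i,j)\in D(\lambda)$ with $(i+1,j+1)\notin D(\lambda)$. Cells of a border strip are ordered from top-right to bottom-left ($(i,j)$ precedes $(i',j')$ iff $i<i'$, or $i=i'$ and $j>j'$). For $u,v\in\mathrm{OB}(\lambda)$, $\mathrm{add}^u_v(\lambda)$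 is the partition whose diagram is $D(\lambda)$ together with the cells of $\mathrm{OB}(\lambda)$ from $u$ to $v$ (inclusive), when this is a Young diagram; for $u,v\in\mathrm{IB}(\lambda)$, $\mathrm{rem}^u_v(\lambda)$ is the partition whose diagram is $D(\lambda)$ minus the cells of $\mathrm{IB}(\lambda)$ from $u$ to $v$, when this is a Young diagram. For $1\le p\le q\le n$ (using the data $r_i,m_i$ of the original $\lambda$) set $\mathrm{add}^p_q=\mathrm{add}^{(r_p+1,m_p)}_{(r_q+1,m_{q+1}+1)}$ and $\mathrm{rem}^p_q=\mathrm{rem}^{(r_p,m_p)}_{(r_q,m_{q+1}+1)}$, and for $1\le p_1<\cdots<p_t\le q_t<\cdots<q_1\le n$, $\mathrm{add}^{p_1,\ldots,p_t}_{q_1,\ldots,q_t}=\mathrm{add}^{p_1}_{q_1}\circ\cdots\circ\mathrm{add}^{p_t}_{q_t}$ and $\mathrm{rem}^{p_1,\ldots,p_t}_{q_1,\ldots,q_t}=\mathrm{rem}^{p_1}_{q_1}\circ\cdots\circ\mathrm{rem}^{p_t}_{q_t}$, each operator acting on the border of the current partition. *)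

theory Defs
  imports
    "HOL-Library.Poly_Mapping"
    "HOL-Library.Product_Lexorder"
    "HOL-Computational_Algebra.Fraction_Field"
    "Jordan_Normal_Form.Determinant"
begin

section \<open>Partitions and Young diagrams\<close>

text \<open>A partition is the weakly decreasing list of its positive parts, so that
  \<open>length lam\<close> is the number of parts. Parts, rows and columns are counted from 1.\<close>

definition is_partition :: "nat list \<Rightarrow> bool" where
  "is_partition lam \<longleftrightarrow> sorted_wrt (\<ge>) lam \<and> 0 \<notin> set lam"

definition part :: "nat list \<Rightarrow> nat \<Rightarrow> nat" where
  "part lam i = (if 1 \<le> i \<and> i \<le> length lam then lam ! (i - 1) else 0)"

definition diagram :: "nat list \<Rightarrow> (nat \<times> nat) set" where
  "diagram lam = {(i, j). 1 \<le> i \<and> i \<le> length lam \<and> 1 \<le> j \<and> j \<le> part lam i}"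

text \<open>Unspecified when the set of cells is not the diagram of a partition.\<close>

definition partition_of_diagram :: "(nat \<times> nat) set \<Rightarrow> nat list" where
  "partition_of_diagram D = (THE mu. is_partition mu \<and> diagram mu = D)"

definition conjugate_partition :: "nat list \<Rightarrow> nat list" where
  "conjugate_partition lam = partition_of_diagram (prod.swap ` diagram lam)"

text \<open>The partitions \<open>lam + (a^l)\<close> and \<open>lam - (a^l)\<close>, for \<open>l \<le> length lam\<close>.
  In the second one, parts that become zero are dropped.\<close>

definition add_first :: "nat \<Rightarrow> nat \<Rightarrow> nat list \<Rightarrow> nat list" where
  "add_first a l lam = map (\<lambda>x. x + a) (take l lam) @ drop l lam"

definition sub_first :: "nat \<Rightarrow> nat \<Rightarrow> nat list \<Rightarrow> nat list" where
  "sub_first a l lam = filter (\<lambda>x. 0 < x) (map (\<lambda>x. x - a) (take l lam) @ drop l lam)"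

definition corners :: "nat list \<Rightarrow> (nat \<times> nat) set" where
  "corners lam = {(i, j). (i, j) \<in> diagram lam \<and>
     (i + 1, j) \<notin> diagram lam \<and> (i, j + 1) \<notin> diagram lam}"

text \<open>The corners, listed from top to bottom, are \<open>(r\<^sub>i, m\<^sub>i)\<close> for \<open>i = 1, \<dots>, n\<close>, with
  \<open>r\<^sub>i = corner_row lam i\<close> and \<open>m\<^sub>i = corner_col lam i\<close>; in addition \<open>m\<^sub>n\<^sub>+\<^sub>1 = 0\<close>.
  Equivalently, the distinct parts are \<open>m\<^sub>1 > \<dots> > m\<^sub>n\<close> and exactly \<open>r\<^sub>i\<close> parts are at least \<open>m\<^sub>i\<close>.\<close>

definition corner_row :: "nat list \<Rightarrow> nat \<Rightarrow> nat" where
  "corner_row lam i = sorted_list_of_set (fst ` corners lam) ! (i - 1)"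

definition corner_col :: "nat list \<Rightarrow> nat \<Rightarrow> nat" where
  "corner_col lam i =
     (if i \<le> card (corners lam) then part lam (corner_row lam i) else 0)"

section \<open>Adding and removing border strips\<close>

definition outside_border :: "nat list \<Rightarrow> (nat \<times> nat) set" where
  "outside_border lam = {(i, j). 1 \<le> i \<and> 1 \<le> j \<and> (i, j) \<notin> diagram lam \<and>
     (i - 1, j - 1) \<in> diagram lam \<union> {(0, j') |j'. j' \<le> part lam 1}
                       \<union> {(i', 0) |i'. i' \<le> length lam}}"

definition inside_border :: "nat list \<Rightarrow> (nat \<times> nat) set" where
  "inside_border lam = {(i, j). (i, j) \<in> diagram lam \<and> (i + 1, j + 1) \<notin> diagram lam}"

text \<open>The reflexive order along a border strip, from top-right to bottom-left.\<close>

definition strip_le :: "nat \<times> nat \<Rightarrow> nat \<times> nat \<Rightarrow> bool" where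
  "strip_le u v \<longleftrightarrow> fst u < fst v \<or> (fst u = fst v \<and> snd v \<le> snd u)"

definition add_strip :: "nat \<times> nat \<Rightarrow> nat \<times> nat \<Rightarrow> nat list \<Rightarrow> nat list" where
  "add_strip u v mu = partition_of_diagram
     (diagram mu \<union> {c \<in> outside_border mu. strip_le u c \<and> strip_le c v})"

definition rem_strip :: "nat \<times> nat \<Rightarrow> nat \<times> nat \<Rightarrow> nat list \<Rightarrow> nat list" where
  "rem_strip u v mu = partition_of_diagram
     (diagram mu - {c \<in> inside_border mu. strip_le u c \<and> strip_le c v})"

text \<open>In the next four operators \<open>lam\<close> only supplies the corner data fixing the end cells
  of the strips, while \<open>mu\<close> is the partition whose border is modified.\<close>

definition add_pq :: "nat list \<Rightarrow> nat \<Rightarrow> nat \<Rightarrow> nat list \<Rightarrow> nat list" where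
  "add_pq lam p q mu =
     add_strip (corner_row lam p + 1, corner_col lam p)
               (corner_row lam q + 1, corner_col lam (q + 1) + 1) mu"

definition rem_pq :: "nat list \<Rightarrow> nat \<Rightarrow> nat \<Rightarrow> nat list \<Rightarrow> nat list" where
  "rem_pq lam p q mu =
     rem_strip (corner_row lam p, corner_col lam p)
               (corner_row lam q, corner_col lam (q + 1) + 1) mu"

text \<open>For \<open>ps = [p\<^sub>1, \<dots>, p\<^sub>t]\<close> and \<open>qs = [q\<^sub>1, \<dots>, q\<^sub>t]\<close> the folds are the compositions in which
  the operator for \<open>(p\<^sub>t, q\<^sub>t)\<close> acts first.\<close>

definition add_list :: "nat list \<Rightarrow> nat list \<Rightarrow> nat list \<Rightarrow> nat list \<Rightarrow> nat list" where
  "add_list lam ps qs mu = foldr (\<lambda>(p, q). add_pq lam p q) (zip ps qs) mu"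

definition rem_list :: "nat list \<Rightarrow> nat list \<Rightarrow> nat list \<Rightarrow> nat list \<Rightarrow> nat list" where
  "rem_list lam ps qs mu = foldr (\<lambda>(p, q). rem_pq lam p q) (zip ps qs) mu"

text \<open>The pairs of sequences \<open>1 \<le> p\<^sub>1 < \<dots> < p\<^sub>t \<le> d\<close> and \<open>d \<le> q\<^sub>t < \<dots> < q\<^sub>1 \<le> n\<close>.\<close>

definition nested_indices :: "nat \<Rightarrow> nat \<Rightarrow> nat \<Rightarrow> (nat list \<times> nat list) set" where
  "nested_indices n d t = {(ps, qs).
     length ps = t \<and> length qs = t \<and>
     sorted_wrt (<) ps \<and> set ps \<subseteq> {1..d} \<and>
     sorted_wrt (>) qs \<and> set qs \<subseteq> {d..n}}"

section \<open>The generic matrix and its Gauss decomposition\<close>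

text \<open>Rational functions over the complex numbers in indeterminates \<open>x\<^sub>i\<^sub>,\<^sub>j\<close> (\<open>i, j :: nat\<close>).
  Only those with \<open>1 \<le> i, j \<le> N\<close> enter the generic \<open>N \<times> N\<close> matrix. The lexicographic order
  on index pairs serves only to make the polynomial ring an instance of \<^class>\<open>idom\<close>.\<close>

type_synonym cpoly = "((nat \<times> nat) \<Rightarrow>\<^sub>0 nat) \<Rightarrow>\<^sub>0 complex"

type_synonym cratfun = "cpoly fract"

definition indet :: "nat \<Rightarrow> nat \<Rightarrow> cratfun" where
  "indet i j = Fract (Poly_Mapping.single (Poly_Mapping.single (i, j) 1) 1) 1"

text \<open>Matrix indices start at 0, so the entry at \<open>(a, b)\<close> is \<open>x\<^sub>a\<^sub>+\<^sub>1\<^sub>,\<^sub>b\<^sub>+\<^sub>1\<close>.\<close>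

definition generic_mat :: "nat \<Rightarrow> cratfun mat" where
  "generic_mat N = mat N N (\<lambda>(a, b). indet (a + 1) (b + 1))"

definition upper_unitriangular :: "'a :: {zero, one} mat \<Rightarrow> bool" where
  "upper_unitriangular A \<longleftrightarrow> upper_triangular A \<and> (\<forall>i < dim_row A. A $$ (i, i) = 1)"

definition gauss_decomposition ::
  "nat \<Rightarrow> 'a :: field mat \<Rightarrow> 'a mat \<Rightarrow> 'a mat \<Rightarrow> 'a mat \<Rightarrow> bool" where
  "gauss_decomposition N A L D U \<longleftrightarrow>
     L \<in> carrier_mat N N \<and> upper_unitriangular (transpose_mat L) \<and>
     D \<in> carrier_mat N N \<and> diagonal_mat D \<and>
     U \<in> carrier_mat N N \<and> upper_unitriangular U \<and>
     A = L * D * U"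

definition X_plus :: "nat \<Rightarrow> cratfun mat" where
  "X_plus N = (THE U. \<exists>L D. gauss_decomposition N (generic_mat N) L D U)"

section \<open>The minors\<close>

text \<open>The condition that \<open>lam\<close> lies in the rectangle with \<open>r\<close> rows and \<open>N - r\<close> columns.\<close>

definition fits :: "nat \<Rightarrow> nat \<Rightarrow> nat list \<Rightarrow> bool" where
  "fits N r lam \<longleftrightarrow> r \<le> N \<and> length lam \<le> r \<and> part lam 1 \<le> N - r"

text \<open>The minor with rows \<open>1, \<dots>, r\<close> and columns \<open>lam\<^sub>r\<^sub>+\<^sub>1\<^sub>-\<^sub>a + a\<close> for \<open>1 \<le> a \<le> r\<close>, which
  increase with \<open>a\<close>. In 0-based indices \<open>b = a - 1\<close>, the column is \<open>lam\<^sub>r\<^sub>-\<^sub>b + b\<close>.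
  Only meaningful if \<open>fits N r lam\<close>.\<close>

definition S_minor :: "nat \<Rightarrow> nat \<Rightarrow> nat list \<Rightarrow> cratfun" where
  "S_minor N r lam = det (mat r r (\<lambda>(i, b). X_plus N $$ (i, part lam (r - b) + b)))"

end

theory Submission
  imports Defs
begin

text \<open>Write \<open>I\<close> and \<open>J\<close> for the columns of the minors of \<open>\<lambda>\<close> of sizes \<open>r\<close> and \<open>r - 1\<close>. The minors of
  \<open>\<lambda> - (1\<^sup>l)\<close> and \<open>\<lambda> + (1\<^sup>l)\<close> arise by exchanging the \<open>l\<close> largest elements of \<open>I\<close> and \<open>J\<close>. Sylvester's
  identity expands their product by exchanging these \<open>l\<close> columns of the second minor with all sets of
  \<open>l\<close> columns of the first one. A term has two equal columns unless the exchanged set differs from the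
  first \<open>l\<close> positions by trading positions of corners \<open>p \<le> d\<close> for positions of corners \<open>q \<ge> d\<close>. Trading
  \<open>t\<close> of them gives the minors of the partitions with \<open>t\<close> nested strips added and removed, with sign
  \<open>(-1)\<^sup>t\<close>. This holds for every matrix. The second identity is the first one for the conjugate
  partition and the matrix \<open>(-1)\<^sup>i\<^sup>+\<^sup>j (X\<^sub>+\<^sup>-\<^sup>1)\<^sub>N\<^sub>+\<^sub>1\<^sub>-\<^sub>j\<^sub>,\<^sub>N\<^sub>+\<^sub>1\<^sub>-\<^sub>i\<close>, by Jacobi's identity for complementary
  minors.\<close>

section \<open>Determinants and Sylvester's exchange identity\<close>

text \<open>Everything rests on one coincidence. The column of row \<open>k + 1\<close> at size
  \<open>r - 1\<close> is one less than its column at size \<open>r\<close>, so it equals the column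
  of row \<open>k + 2\<close> at size \<open>r\<close> exactly when the two rows have equal parts.
  An exchange that leaves such a pair in the same minor contributes nothing, and a free choice
  remains only at the corner rows. The index \<open>d\<close> can occur both among the
  \<open>p\<close> and among the \<open>q\<close>, because the corner row \<open>l\<close> lets row
  \<open>l\<close> leave the exchanged set and row \<open>l + 1\<close> enter it, independently of
  each other. Exchanging the first \<open>l\<close> positions themselves undoes both shifts and
  returns the two minors of \<lambda>. This is the term without strips; solving for it turns the
  sign \<open>(-1) ^ t\<close> into \<open>(-1) ^ (t - 1)\<close>. Passing to complementary columns
  replaces the sizes \<open>r\<close> and \<open>r + 1\<close> by \<open>N - r\<close> and
  \<open>N - r - 1\<close>. The larger size thus becomes the smaller one, which is why the second
  identity is an instance of the first, once that is known for arbitrary entries.\<close>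

definition fdet :: "nat \<Rightarrow> (nat \<Rightarrow> nat \<Rightarrow> 'a) \<Rightarrow> 'a :: idom" where
  "fdet n f = det (mat n n (\<lambda>(i, j). f i j))"

lemma fdet_cong:
  assumes "\<And>i j. i < n \<Longrightarrow> j < n \<Longrightarrow> f i j = g i j"
  shows "fdet n f = fdet n g"
  unfolding fdet_def by (rule arg_cong[of _ _ det]) (auto intro!: eq_matI simp: assms)

lemma fdet_eq_sum_rows:
  "fdet n f = (\<Sum>p | p permutes {0..<n}. signof p * (\<Prod>i = 0..<n. f i (p i)))"
  unfolding fdet_def by (subst det_def') (auto intro!: sum.cong prod.cong)

lemma fdet_transpose: "fdet n (\<lambda>i j. f j i) = fdet n f"
proof -
  have "transpose_mat (mat n n (\<lambda>(i, j). f i j)) = mat n n (\<lambda>(i, j). f j i)"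
    by (auto intro!: eq_matI)
  then show ?thesis
    unfolding fdet_def using det_transpose[of "mat n n (\<lambda>(i, j). f i j)" n] by simp
qed

lemma fdet_eq_sum_cols:
  "fdet n f = (\<Sum>p | p permutes {0..<n}. signof p * (\<Prod>j = 0..<n. f (p j) j))"
  by (subst fdet_transpose[symmetric]) (rule fdet_eq_sum_rows)

lemma fdet_permute_rows:
  assumes "p permutes {0..<n}"
  shows "fdet n (\<lambda>i j. f (p i) j) = signof p * fdet n f"
proof -
  have "mat n n (\<lambda>(i, j). f (p i) j) = mat n n (\<lambda>(i, j). mat n n (\<lambda>(i, j). f i j) $$ (p i, j))"
  proof (rule eq_matI)
    fix i j assume "i < dim_row (mat n n (\<lambda>(i, j). mat n n (\<lambda>(i, j). f i j) $$ (p i, j)))"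
      "j < dim_col (mat n n (\<lambda>(i, j). mat n n (\<lambda>(i, j). f i j) $$ (p i, j)))"
    then show "mat n n (\<lambda>(i, j). f (p i) j) $$ (i, j) =
        mat n n (\<lambda>(i, j). mat n n (\<lambda>(i, j). f i j) $$ (p i, j)) $$ (i, j)"
      using permutes_in_image[OF assms, of i] by simp
  qed simp_all
  then show ?thesis
    unfolding fdet_def using det_permute_rows[OF _ assms, of "mat n n (\<lambda>(i, j). f i j)"] by simp
qed

lemma fdet_permute_cols:
  assumes "p permutes {0..<n}"
  shows "fdet n (\<lambda>i j. f i (p j)) = signof p * fdet n f"
  by (metis (no_types) fdet_permute_rows[OF assms, of "\<lambda>i j. f j i"] fdet_transpose[of n f]
    fdet_transpose[of n "\<lambda>i j. f j (p i)"])

lemma fdet_identical_cols: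
  assumes "a < n" "b < n" "a \<noteq> b" "\<And>i. i < n \<Longrightarrow> f i a = f i b"
  shows "fdet n f = 0"
  unfolding fdet_def
  by (rule det_identical_columns[OF _ assms(3,1,2)]) (use assms in \<open>auto intro!: eq_vecI\<close>)

lemma fdet_col_add:
  assumes "k < n"
  shows "fdet n (\<lambda>i j. if j = k then a i + b i else f i j) =
    fdet n (\<lambda>i j. if j = k then a i else f i j) + fdet n (\<lambda>i j. if j = k then b i else f i j)"
proof -
  have split: "(\<Prod>j = 0..<n. if j = k then h (p j) else f (p j) j) =
      h (p k) * (\<Prod>j \<in> {0..<n} - {k}. f (p j) j)" for h :: "nat \<Rightarrow> 'a" and p
    using assms by (subst prod.remove[of _ k]) (auto intro!: prod.cong)
  show ?thesis
    unfolding fdet_eq_sum_cols split[of "\<lambda>x. a x + b x"] split[of a] split[of b]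
    by (simp add: algebra_simps sum.distrib)
qed

lemma fdet_cols_subsets:
  assumes "finite F" "F \<subseteq> {..<n}"
  shows "fdet n (\<lambda>i j. if j \<in> F then a i j + b i j else f i j) =
    (\<Sum>K\<in>Pow F. fdet n (\<lambda>i j. if j \<in> F then if j \<in> K then b i j else a i j else f i j))"
  using assms
proof (induction arbitrary: f)
  case (insert k F)
  have k: "k < n" and F: "F \<subseteq> {..<n}"
    using insert.prems by auto
  let ?D = "\<lambda>c K. fdet n (\<lambda>i j. if j \<in> F then if j \<in> K then b i j else a i j
                          else if j = k then c i else f i j)"
  have part: "fdet n (\<lambda>i j. if j = k then c i else if j \<in> F then a i j + b i j else f i j) =
      (\<Sum>K\<in>Pow F. ?D c K)" for c
  proof -
    have "fdet n (\<lambda>i j. if j = k then c i else if j \<in> F then a i j + b i j else f i j) =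
      fdet n (\<lambda>i j. if j \<in> F then a i j + b i j else if j = k then c i else f i j)"
      using insert.hyps by (auto intro!: fdet_cong)
    also have "\<dots> = (\<Sum>K\<in>Pow F. ?D c K)"
      by (rule insert.IH[OF F])
    finally show ?thesis .
  qed
  have "fdet n (\<lambda>i j. if j \<in> insert k F then a i j + b i j else f i j) =
    fdet n (\<lambda>i j. if j = k then a i k + b i k else if j \<in> F then a i j + b i j else f i j)"
    by (auto intro!: fdet_cong)
  also have "\<dots> = (\<Sum>K\<in>Pow F. ?D (\<lambda>i. a i k) K) + (\<Sum>K\<in>Pow F. ?D (\<lambda>i. b i k) K)"
    by (subst fdet_col_add[OF k]) (simp only: part)
  also have "(\<Sum>K\<in>Pow F. ?D (\<lambda>i. a i k) K) =
      (\<Sum>K\<in>Pow F. fdet n (\<lambda>i j. if j \<in> insert k F then if j \<in> K then b i j else a i j else f i j))"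
    using insert.hyps by (intro sum.cong fdet_cong) auto
  also have "(\<Sum>K\<in>Pow F. ?D (\<lambda>i. b i k) K) =
      (\<Sum>K\<in>Pow F. fdet n (\<lambda>i j. if j \<in> insert k F then if j \<in> insert k K then b i j else a i j else f i j))"
    using insert.hyps by (intro sum.cong fdet_cong) auto
  also have "\<dots> = (\<Sum>K\<in>insert k ` Pow F.
      fdet n (\<lambda>i j. if j \<in> insert k F then if j \<in> K then b i j else a i j else f i j))"
    using insert.hyps by (subst sum.reindex) (auto simp: inj_on_def)
  finally show ?case
    using insert.hyps by (simp only: Pow_insert)
      (subst sum.union_disjoint, auto)
qed simp

lemma fdet_block:
  assumes "\<And>i j. r \<le> i \<Longrightarrow> i < r + s \<Longrightarrow> j < r \<Longrightarrow> f i j = 0"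
  shows "fdet (r + s) f = fdet r f * fdet s (\<lambda>i j. f (r + i) (r + j))"
proof -
  have "mat (r + s) (r + s) (\<lambda>(i, j). f i j) =
    four_block_mat (mat r r (\<lambda>(i, j). f i j)) (mat r s (\<lambda>(i, j). f i (r + j)))
      (0\<^sub>m s r) (mat s s (\<lambda>(i, j). f (r + i) (r + j)))"
    using assms by (auto intro!: eq_matI)
  then show ?thesis
    unfolding fdet_def by (simp add: det_four_block_mat_lower_left_zero[of _ r _ s])
qed

text \<open>No permutation can match the first \<open>r\<close> rows with \<open>T\<close> and the others with the complement.\<close>

lemma fdet_eq_0_if_support:
  assumes "r \<le> n" "T \<subseteq> {..<n}" "card T \<noteq> r"
    and supp: "\<And>i j. i < n \<Longrightarrow> j < n \<Longrightarrow> f i j \<noteq> 0 \<Longrightarrow> i < r \<longleftrightarrow> j \<in> T"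
  shows "fdet n f = 0"
  unfolding fdet_eq_sum_rows
proof (rule sum.neutral, rule ballI)
  fix p assume "p \<in> {p. p permutes {0..<n}}"
  then have p: "p permutes {0..<n}" by simp
  have "(\<Prod>i = 0..<n. f i (p i)) = 0"
  proof (rule ccontr)
    assume "(\<Prod>i = 0..<n. f i (p i)) \<noteq> 0"
    then have nz: "f i (p i) \<noteq> 0" if "i < n" for i using that by auto
    have pn: "p i < n \<longleftrightarrow> i < n" for i using permutes_in_image[OF p, of i] by simp
    have "p ` {..<r} = T"
    proof
      show "p ` {..<r} \<subseteq> T"
      proof
        fix x assume "x \<in> p ` {..<r}"
        then obtain i where i: "i < r" "x = p i" by auto
        then have "i < n" using assms(1) by simp
        with i show "x \<in> T" using supp[of i "p i"] nz[of i] pn[of i] by simp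
      qed
      show "T \<subseteq> p ` {..<r}"
      proof
        fix x assume x: "x \<in> T"
        then have xn: "x < n" using assms(2) by auto
        obtain i where i: "p i = x" using permutes_surj[OF p] by (metis surjD)
        then have "i < n" using pn[of i] xn by simp
        then have "i < r" using nz[of i] supp[of i x] x xn i by simp
        then show "x \<in> p ` {..<r}" using i by blast
      qed
    qed
    then show False
      using assms(3) card_image[OF permutes_inj_on[OF p, of "{..<r}"]] by simp
  qed
  then show "signof p * (\<Prod>i = 0..<n. f i (p i)) = 0" by simp
qed

section \<open>Sylvester's exchange expansion of a product of two minors\<close>

lemma fdet_sub_rows:
  assumes "s \<le> r"
  shows "fdet (r + s) (\<lambda>i j. if i < r then f i j else f i j - f (i - r) j) = fdet (r + s) f"
proof -
  \<comment> \<open>Left multiplication by \<open>P\<close> carries out all row subtractions at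
    once, and \<open>P\<close> is unit lower triangular.\<close>
  define P :: "'a mat" where "P = mat (r + s) (r + s)
    (\<lambda>(i, k). if k = i then 1 else if r \<le> i \<and> k = i - r then - 1 else 0)"
  let ?f = "mat (r + s) (r + s) (\<lambda>(i, j). f i j)"
  have P: "P \<in> carrier_mat (r + s) (r + s)" by (simp add: P_def)
  have "det P = prod_list (diag_mat P)"
    by (rule det_lower_triangular[OF _ P]) (use assms in \<open>auto simp: P_def\<close>)
  also have "diag_mat P = map (\<lambda>i. 1) [0..<r + s]"
    unfolding diag_mat_def by (auto simp: P_def)
  finally have det: "det P = 1" by (simp add: prod_list_replicate map_replicate_const)
  have "mat (r + s) (r + s) (\<lambda>(i, j). if i < r then f i j else f i j - f (i - r) j) = P * ?f"
  proof (rule eq_matI)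
    fix i j assume "i < dim_row (P * ?f)" "j < dim_col (P * ?f)"
    then have ij: "i < r + s" "j < r + s" by (auto simp: P_def)
    have "(P * ?f) $$ (i, j) = (\<Sum>k = 0..<r + s. P $$ (i, k) * f k j)"
      using ij by (auto simp: P_def scalar_prod_def intro!: sum.cong)
    also have "\<dots> = (\<Sum>k = 0..<r + s. (if k = i then f i j else 0) -
        (if k = i - r then if r \<le> i then f (i - r) j else 0 else 0))"
      using ij assms by (intro sum.cong) (auto simp: P_def)
    also have "\<dots> = f i j - (if r \<le> i then f (i - r) j else 0)"
      using ij by (auto simp: sum_subtractf)
    finally show "mat (r + s) (r + s) (\<lambda>(i, j). if i < r then f i j else f i j - f (i - r) j) $$ (i, j)
      = (P * ?f) $$ (i, j)" using ij by auto
  qed (auto simp: P_def)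
  then show ?thesis
    unfolding fdet_def using det_mult[OF P, of ?f] det by simp
qed

text \<open>A block matrix with \<open>r + s\<close> rows. A column is supported in the upper block (the first
  \<open>r\<close> rows) if it is \<open>u j\<close> with \<open>j \<notin> K\<close> or \<open>w j\<close> with \<open>j \<in> L\<close>, and otherwise in the lower block,
  which sees only the first \<open>s\<close> rows of \<open>A\<close>.\<close>

definition exchange_mat ::
  "(nat \<Rightarrow> nat \<Rightarrow> 'a) \<Rightarrow> nat \<Rightarrow> nat set \<Rightarrow> (nat \<Rightarrow> nat) \<Rightarrow> (nat \<Rightarrow> nat) \<Rightarrow> nat set \<Rightarrow>
    nat \<Rightarrow> nat \<Rightarrow> 'a :: idom" where
  "exchange_mat A r L u w K i j =
    (if j < r then if (j \<in> K) = (i < r) then 0 else A (if i < r then i else i - r) (u j)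
     else if (j - r \<in> L) = (i < r) then A (if i < r then i else i - r) (w (j - r)) else 0)"

text \<open>Let each of the first \<open>r\<close> columns have \<open>u j\<close> in both blocks. Subtracting the upper block from
  the lower one makes the matrix block triangular, which gives the left-hand side, while
  multilinearity in these columns gives the sum over \<open>K\<close>.\<close>

lemma sylvester_expansion:
  fixes A :: "nat \<Rightarrow> nat \<Rightarrow> 'a :: idom"
  assumes "s \<le> r" "L \<subseteq> {..<s}"
  shows "fdet r (\<lambda>i k. A i (u k)) * fdet s (\<lambda>i k. A i (w k)) =
    (\<Sum>K\<in>Pow {..<r}. (-1) ^ card L * fdet (r + s) (exchange_mat A r L u w K))"
proof -
  define B where "B i j = (if j < r then A (if i < r then i else i - r) (u j)
     else if (j - r \<in> L) = (i < r) then A (if i < r then i else i - r) (w (j - r)) else 0)" for i j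
  have "fdet (r + s) B = fdet (r + s) (\<lambda>i j. if i < r then B i j else B i j - B (i - r) j)"
    by (rule fdet_sub_rows[OF assms(1), symmetric])
  also have "\<dots> = fdet r (\<lambda>i j. if i < r then B i j else B i j - B (i - r) j) *
      fdet s (\<lambda>i j. if r + i < r then B (r + i) (r + j) else B (r + i) (r + j) - B (r + i - r) (r + j))"
    using assms by (intro fdet_block) (auto simp: B_def)
  also have "fdet r (\<lambda>i j. if i < r then B i j else B i j - B (i - r) j) = fdet r (\<lambda>i k. A i (u k))"
    by (intro fdet_cong) (auto simp: B_def)
  \<comment> \<open>A column in \<open>L\<close> has entries in the upper block only, so the
    subtraction leaves its negative below. This produces the factor
    \<open>(-1) ^ card L\<close>.\<close>
  also have "fdet s (\<lambda>i j. if r + i < r then B (r + i) (r + j) else B (r + i) (r + j) - B (r + i - r) (r + j))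
      = fdet s (\<lambda>i k. (if k \<in> L then - 1 else 1) * A i (w k))"
    using assms by (intro fdet_cong) (auto simp: B_def)
  also have "\<dots> = (-1) ^ card L * fdet s (\<lambda>i k. A i (w k))"
  proof -
    have "(\<Prod>k = 0..<s. if k \<in> L then - 1 else 1) = ((-1) ^ card L :: 'a)"
    proof -
      have "{0..<s} \<inter> {k. k \<in> L} = L" using assms(2) by auto
      then show ?thesis by (simp add: prod.If_cases)
    qed
    then show ?thesis
      unfolding fdet_eq_sum_cols by (simp add: prod.distrib sum_distrib_left mult_ac)
  qed
  finally have 0: "fdet (r + s) B =
      fdet r (\<lambda>i k. A i (u k)) * ((-1) ^ card L * fdet s (\<lambda>i k. A i (w k)))" .
  have "(-1) ^ card L * fdet (r + s) B = ((-1) ^ card L * (-1) ^ card L) *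
      (fdet r (\<lambda>i k. A i (u k)) * fdet s (\<lambda>i k. A i (w k)))"
    unfolding 0 by (simp only: mult_ac)
  then have 1: "(-1) ^ card L * fdet (r + s) B =
      fdet r (\<lambda>i k. A i (u k)) * fdet s (\<lambda>i k. A i (w k))"
    by (simp flip: power_mult_distrib)
  \<comment> \<open>Each of the first \<open>r\<close> columns is the sum of its upper and its lower
    half; \<open>K\<close> collects the columns for which the lower half is taken.\<close>
  have "fdet (r + s) B = fdet (r + s) (\<lambda>i j. if j \<in> {..<r} then
      (if i < r then B i j else 0) + (if i < r then 0 else B i j) else B i j)"
    by (intro fdet_cong) auto
  also have "\<dots> = (\<Sum>K\<in>Pow {..<r}. fdet (r + s) (exchange_mat A r L u w K))"
    by (subst fdet_cols_subsets) (auto intro!: sum.cong fdet_cong simp: B_def exchange_mat_def)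
  finally show ?thesis
    using 1 by (simp add: sum_distrib_left)
qed

text \<open>The columns supported in the upper \<open>r\<close> rows number
  \<open>r - card K + card L\<close>, so a nonzero Leibniz term forces
  \<open>card K = card L\<close>.\<close>

lemma exchange_mat_card_neq:
  assumes "L \<subseteq> {..<s}" "K \<subseteq> {..<r}" "card K \<noteq> card L"
  shows "fdet (r + s) (exchange_mat A r L u w K) = 0"
proof (rule fdet_eq_0_if_support)
  let ?T = "({..<r} - K) \<union> (+) r ` L"
  have fin: "finite L" "finite K" using assms finite_subset by auto
  have "card ?T = card ({..<r} - K) + card ((+) r ` L)"
    using fin by (intro card_Un_disjoint) auto
  also have "\<dots> = r - card K + card L"
    using assms fin by (simp add: card_Diff_subset card_image)
  finally show "card ?T \<noteq> r"
    using assms(3) card_mono[OF _ assms(2)] by simp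
  show "?T \<subseteq> {..<r + s}" using assms by auto
  show "i < r \<longleftrightarrow> j \<in> ?T" if "i < r + s" "j < r + s" "exchange_mat A r L u w K i j \<noteq> 0" for i j
  proof (cases "j < r")
    case False
    then have "j \<in> (+) r ` L \<longleftrightarrow> j - r \<in> L"
      by (metis image_iff le_add_diff_inverse not_less add_diff_cancel_left')
    with False that show ?thesis by (auto simp: exchange_mat_def split: if_splits)
  qed (use that in \<open>auto simp: exchange_mat_def split: if_splits\<close>)
qed simp

text \<open>The witness is the product of the disjoint transpositions of \<open>\<sigma> k\<close>
  with \<open>r + k\<close>, one for each \<open>k\<close> in \<open>F\<close>, whence the
  sign.\<close>

lemma exists_swapping_permutation:
  assumes "finite F" "inj_on \<sigma> F" "\<sigma> ` F \<subseteq> {..<r}" "F \<subseteq> {..<s}"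
  shows "\<exists>p. p permutes {0..<r + s} \<and> signof p = ((-1) ^ card F :: int) \<and>
    (\<forall>k\<in>F. p (\<sigma> k) = r + k \<and> p (r + k) = \<sigma> k) \<and>
    (\<forall>j. j \<notin> \<sigma> ` F \<longrightarrow> j \<notin> (+) r ` F \<longrightarrow> p j = j)"
  using assms
proof induction
  case empty
  show ?case by (rule exI[of _ id]) (simp add: permutes_id[unfolded id_def])
next
  case (insert x F)
  then obtain p where p: "p permutes {0..<r + s}" "signof p = ((-1) ^ card F :: int)"
    "\<And>k. k \<in> F \<Longrightarrow> p (\<sigma> k) = r + k \<and> p (r + k) = \<sigma> k"
    "\<And>j. j \<notin> \<sigma> ` F \<Longrightarrow> j \<notin> (+) r ` F \<Longrightarrow> p j = j"
    by auto
  let ?t = "Transposition.transpose (\<sigma> x) (r + x)"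
  have x: "\<sigma> x < r" "x < s" using insert.prems by auto
  have F: "\<And>k. k \<in> F \<Longrightarrow> \<sigma> k < r \<and> \<sigma> k \<noteq> \<sigma> x \<and> k \<noteq> x"
    using insert.prems insert.hyps by (auto simp: inj_on_def)
  have px: "p (\<sigma> x) = \<sigma> x" "p (r + x) = r + x"
  proof -
    have "\<sigma> x \<notin> \<sigma> ` F" "\<sigma> x \<notin> (+) r ` F" using F x by (metis imageE, auto)
    then show "p (\<sigma> x) = \<sigma> x" by (rule p(4))
    have "r + x \<notin> \<sigma> ` F" using F by (metis imageE not_add_less1)
    moreover have "r + x \<notin> (+) r ` F" using insert.hyps by auto
    ultimately show "p (r + x) = r + x" by (rule p(4))
  qed
  have t: "?t permutes {0..<r + s}" using x by (intro permutes_swap_id) auto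
  show ?case
  proof (intro exI[of _ "?t \<circ> p"] conjI ballI allI impI)
    show "?t \<circ> p permutes {0..<r + s}" by (rule permutes_compose[OF p(1) t])
    show "signof (?t \<circ> p) = ((-1) ^ card (insert x F) :: int)"
      using sign_compose[OF permutes_imp_permutation[OF _ t] permutes_imp_permutation[OF _ p(1)]]
        x p(2) insert.hyps by (simp add: sign_swap_id)
  next
    fix k assume "k \<in> insert x F"
    then show "(?t \<circ> p) (\<sigma> k) = r + k" "(?t \<circ> p) (r + k) = \<sigma> k"
      using px p(3)[of k] F[of k] x by (auto simp: Transposition.transpose_def)
  next
    fix j assume "j \<notin> \<sigma> ` insert x F" "j \<notin> (+) r ` insert x F"
    then show "(?t \<circ> p) j = j"
      using p(4)[of j] by (auto simp: Transposition.transpose_def)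
  qed
qed

text \<open>Swapping the columns \<open>\<sigma> k\<close> and \<open>r + k\<close> for all
  \<open>k\<close> in \<open>L\<close> separates the two blocks and costs exactly the factor
  \<open>(-1) ^ card L\<close>. The same bijection places the exchanged columns in both minors, so
  another choice of \<open>\<sigma>\<close> changes both determinants by the same sign. Hence the
  most convenient \<open>\<sigma>\<close> may be used later.\<close>

lemma exchange_mat_bij:
  fixes A :: "nat \<Rightarrow> nat \<Rightarrow> 'a :: idom"
  assumes "L \<subseteq> {..<s}" "K \<subseteq> {..<r}" "bij_betw \<sigma> L K"
    and u1: "\<And>k. k \<in> L \<Longrightarrow> u' (\<sigma> k) = w k" and u2: "\<And>k. k < r \<Longrightarrow> k \<notin> K \<Longrightarrow> u' k = u k"
    and w1: "\<And>k. k \<in> L \<Longrightarrow> w' k = u (\<sigma> k)" and w2: "\<And>k. k < s \<Longrightarrow> k \<notin> L \<Longrightarrow> w' k = w k"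
  shows "(-1) ^ card L * fdet (r + s) (exchange_mat A r L u w K) =
    fdet r (\<lambda>i k. A i (u' k)) * fdet s (\<lambda>i k. A i (w' k))"
proof -
  let ?E = "exchange_mat A r L u w K"
  have \<sigma>: "inj_on \<sigma> L" "\<sigma> ` L = K" using assms(3) by (auto simp: bij_betw_def)
  obtain p where p: "p permutes {0..<r + s}" "signof p = ((-1) ^ card L :: int)"
    "\<And>k. k \<in> L \<Longrightarrow> p (\<sigma> k) = r + k \<and> p (r + k) = \<sigma> k"
    "\<And>j. j \<notin> K \<Longrightarrow> j \<notin> (+) r ` L \<Longrightarrow> p j = j"
    using exists_swapping_permutation[OF finite_subset[OF assms(1)] \<sigma>(1), of r s] assms \<sigma> by auto
  have low: "p j = (if j \<in> K then r + inv_into L \<sigma> j else j)" if "j < r" for j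
    using p(3)[of "inv_into L \<sigma> j"] p(4)[of j] \<sigma> that f_inv_into_f[of j \<sigma> L]
    by (auto simp: inv_into_into)
  have high: "p (r + j) = (if j \<in> L then \<sigma> j else r + j)" for j
  proof (cases "j \<in> L")
    case False
    then have "r + j \<notin> K" "r + j \<notin> (+) r ` L" using assms(2) by auto
    from p(4)[OF this] False show ?thesis by simp
  qed (simp add: p(3))
  have "(-1) ^ card L * fdet (r + s) ?E = fdet (r + s) (\<lambda>i j. ?E i (p j))"
    using fdet_permute_cols[OF p(1), of ?E] p(2) by simp
  also have "\<dots> = fdet r (\<lambda>i j. ?E i (p j)) * fdet s (\<lambda>i j. ?E (r + i) (p (r + j)))"
  proof (rule fdet_block)
    fix i j assume "r \<le> i" "j < r"
    then show "?E i (p j) = 0"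
      using \<sigma> by (auto simp: low exchange_mat_def inv_into_into)
  qed
  also have "fdet r (\<lambda>i j. ?E i (p j)) = fdet r (\<lambda>i k. A i (u' k))"
  proof (rule fdet_cong)
    fix i j assume ij: "i < r" "j < r"
    show "?E i (p j) = A i (u' j)"
    proof (cases "j \<in> K")
      case True
      then have "u' j = w (inv_into L \<sigma> j)" "inv_into L \<sigma> j \<in> L"
        using u1[of "inv_into L \<sigma> j"] \<sigma> f_inv_into_f[of j \<sigma> L] inv_into_into[of j \<sigma> L] by auto
      with True ij show ?thesis by (auto simp: low exchange_mat_def)
    qed (use ij in \<open>auto simp: low exchange_mat_def u2\<close>)
  qed
  also have "fdet s (\<lambda>i j. ?E (r + i) (p (r + j))) = fdet s (\<lambda>i k. A i (w' k))"
    using assms(2) \<sigma> by (intro fdet_cong) (auto simp: high exchange_mat_def w1 w2)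
  finally show ?thesis .
qed

section \<open>Partitions, corners and border strips\<close>

lemma diagram_iff: "(i, j) \<in> diagram lam \<longleftrightarrow> 1 \<le> i \<and> 1 \<le> j \<and> j \<le> part lam i"
  by (auto simp: diagram_def part_def)

lemma part_eq_0: "length lam < i \<Longrightarrow> part lam i = 0"
  by (simp add: part_def)

lemma part_antimono:
  assumes "is_partition lam" "1 \<le> i" "i \<le> j"
  shows "part lam j \<le> part lam i"
proof (cases "i < j \<and> j \<le> length lam")
  case True
  then show ?thesis
    using assms unfolding is_partition_def part_def
    by (auto dest: sorted_wrt_nth_less[of "(\<ge>)" lam "i - 1" "j - 1"])
qed (use assms in \<open>auto simp: part_def\<close>)

lemma part_pos_iff:
  assumes "is_partition lam"
  shows "0 < part lam i \<longleftrightarrow> 1 \<le> i \<and> i \<le> length lam"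
proof -
  have "lam ! (i - 1) \<in> set lam" if "1 \<le> i" "i \<le> length lam"
    using that by (intro nth_mem) auto
  then have "lam ! (i - 1) \<noteq> 0" if "1 \<le> i" "i \<le> length lam"
    using that assms by (metis is_partition_def)
  then show ?thesis by (auto simp: part_def)
qed

lemma partition_eqI:
  assumes "is_partition lam" "is_partition mu" "\<And>i. 1 \<le> i \<Longrightarrow> part lam i = part mu i"
  shows "lam = mu"
proof -
  have "i \<le> length lam \<longleftrightarrow> i \<le> length mu" if "1 \<le> i" for i
    using part_pos_iff[OF assms(1), of i] part_pos_iff[OF assms(2), of i] assms(3)[of i] that by simp
  from this[of "length lam"] this[of "length mu"] have len: "length lam = length mu"
    by (cases "length lam"; cases "length mu") auto
  show ?thesis
  proof (rule nth_equalityI[OF len])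
    fix k assume "k < length lam"
    then show "lam ! k = mu ! k" using assms(3)[of "Suc k"] len by (simp add: part_def)
  qed
qed

lemma diagram_eqD:
  assumes "diagram lam = diagram mu" "1 \<le> i"
  shows "part lam i = part mu i"
proof -
  have "1 \<le> j \<and> j \<le> part lam i \<longleftrightarrow> 1 \<le> j \<and> j \<le> part mu i" for j
    using assms diagram_iff[of i j lam] diagram_iff[of i j mu] by simp
  from this[of "part lam i"] this[of "part mu i"] show ?thesis
    by (cases "part lam i"; cases "part mu i") auto
qed

lemma partition_of_diagram_diagram:
  assumes "is_partition mu"
  shows "partition_of_diagram (diagram mu) = mu"
  unfolding partition_of_diagram_def
  by (rule the_equality) (use assms in \<open>auto intro: partition_eqI diagram_eqD\<close>)

lemma antimono_from_1:
  fixes f :: "nat \<Rightarrow> nat"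
  assumes "\<And>i. 1 \<le> i \<Longrightarrow> f (Suc i) \<le> f i" "1 \<le> i" "i \<le> j"
  shows "f j \<le> f i"
  using assms(3,2) by (induction rule: dec_induct) (auto intro: order_trans[OF assms(1)])

lemma exists_partition:
  fixes f :: "nat \<Rightarrow> nat"
  assumes mono: "\<And>i. 1 \<le> i \<Longrightarrow> f (Suc i) \<le> f i" and fin: "\<And>i. n < i \<Longrightarrow> f i = 0"
  shows "\<exists>mu. is_partition mu \<and> (\<forall>i\<ge>1. part mu i = f i)"
proof -
  \<comment> \<open>\<open>k\<close> is the number of positive parts; the search begins at
    \<open>f 1\<close>, since \<open>f 0\<close> is unconstrained.\<close>
  define k where "k = (LEAST k. f (Suc k) = 0)"
  have fk: "f (Suc k) = 0" unfolding k_def by (rule LeastI[of _ n]) (simp add: fin)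
  have pos: "0 < f i" if "1 \<le> i" "i \<le> k" for i
    using not_less_Least[of "i - 1" "\<lambda>k. f (Suc k) = 0"] that by (simp add: k_def)
  let ?mu = "map f [1..<Suc k]"
  have "sorted_wrt (\<ge>) ?mu"
    unfolding sorted_wrt_iff_nth_less
    using antimono_from_1[of f, OF mono] by (auto simp del: upt_Suc)
  moreover have "0 \<notin> set ?mu" using pos by fastforce
  moreover have "part ?mu i = f i" if "1 \<le> i" for i
  proof (cases "i \<le> k")
    case False
    then have "f i = 0" using antimono_from_1[of f "Suc k" i, OF mono] fk by auto
    with False show ?thesis by (simp add: part_def)
  qed (use that in \<open>auto simp: part_def simp del: upt_Suc\<close>)
  ultimately show ?thesis by (intro exI[of _ ?mu]) (auto simp: is_partition_def)
qed

lemma partition_of_diagram_parts: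
  fixes f :: "nat \<Rightarrow> nat"
  assumes "\<And>i. 1 \<le> i \<Longrightarrow> f (Suc i) \<le> f i" and "\<And>i. n < i \<Longrightarrow> f i = 0"
    and D: "\<And>i j. (i, j) \<in> D \<longleftrightarrow> 1 \<le> i \<and> 1 \<le> j \<and> j \<le> f i"
  shows "is_partition (partition_of_diagram D)" (is ?A)
    and "\<And>i. 1 \<le> i \<Longrightarrow> part (partition_of_diagram D) i = f i"
proof -
  obtain mu where mu: "is_partition mu" "\<And>i. 1 \<le> i \<Longrightarrow> part mu i = f i"
    using exists_partition[of f n] assms by auto
  then have "diagram mu = D" using D by (auto simp: diagram_iff)
  then have "partition_of_diagram D = mu"
    using partition_of_diagram_diagram[OF mu(1)] by simp
  then show ?A "\<And>i. 1 \<le> i \<Longrightarrow> part (partition_of_diagram D) i = f i" using mu by auto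
qed

text \<open>The equivalence is a Galois connection between the two part functions. It describes the
  conjugate without reference to cells, and the later facts about conjugation are derived from
  it.\<close>

lemma conjugate_partition:
  assumes "is_partition lam"
  shows is_partition_conjugate: "is_partition (conjugate_partition lam)" (is ?A)
    and le_part_conjugate_iff: "\<And>i j. 1 \<le> i \<Longrightarrow> 1 \<le> j \<Longrightarrow>
      i \<le> part (conjugate_partition lam) j \<longleftrightarrow> j \<le> part lam i"
proof -
  define f where "f j = card {i \<in> {1..length lam}. j \<le> part lam i}" for j
  have f: "i \<le> f j \<longleftrightarrow> j \<le> part lam i" if ij: "1 \<le> i" "1 \<le> j" for i j
  proof
    assume *: "i \<le> f j"
    show "j \<le> part lam i"
    proof (rule ccontr)
      assume "\<not> j \<le> part lam i"
      then have "k < i" if "1 \<le> k" "j \<le> part lam k" for k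
        using part_antimono[OF assms ij(1), of k] that by (meson le_trans not_le)
      then have "{i \<in> {1..length lam}. j \<le> part lam i} \<subseteq> {1..<i}" by auto
      from card_mono[OF _ this] have "f j \<le> i - 1" by (simp add: f_def)
      then show False using * ij by simp
    qed
  next
    assume *: "j \<le> part lam i"
    then have "i \<le> length lam" using part_eq_0[of lam i] ij by fastforce
    moreover have "j \<le> part lam k" if "1 \<le> k" "k \<le> i" for k
      using part_antimono[OF assms that] * by simp
    ultimately have "{1..i} \<subseteq> {i \<in> {1..length lam}. j \<le> part lam i}" by auto
    from card_mono[OF _ this] show "i \<le> f j" by (simp add: f_def)
  qed
  have mono: "f (Suc j) \<le> f j" for j unfolding f_def by (intro card_mono) auto
  have zero: "f j = 0" if "part lam 1 < j" for j
    using f[of 1 j] that by simp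
  have D: "(j, i) \<in> prod.swap ` diagram lam \<longleftrightarrow> 1 \<le> j \<and> 1 \<le> i \<and> i \<le> f j" for i j
    using f[of i j] by (auto simp: diagram_iff)
  note pod = partition_of_diagram_parts[of f "part lam 1" "prod.swap ` diagram lam", OF mono zero D]
  show ?A using pod(1) by (simp add: conjugate_partition_def)
  show "i \<le> part (conjugate_partition lam) j \<longleftrightarrow> j \<le> part lam i" if "1 \<le> i" "1 \<le> j" for i j
    using pod(2)[of j] f that by (simp add: conjugate_partition_def)
qed

lemma conjugate_conjugate:
  assumes "is_partition lam"
  shows "conjugate_partition (conjugate_partition lam) = lam"
proof (rule partition_eqI)
  show P: "is_partition (conjugate_partition (conjugate_partition lam))"
    by (intro is_partition_conjugate assms)
  fix i :: nat assume i: "1 \<le> i"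
  have "j \<le> part (conjugate_partition (conjugate_partition lam)) i \<longleftrightarrow> j \<le> part lam i" if "1 \<le> j" for j
    using le_part_conjugate_iff[OF assms, of i j]
      le_part_conjugate_iff[OF is_partition_conjugate[OF assms], of j i] i that by simp
  from this[of "part lam i"] this[of "part (conjugate_partition (conjugate_partition lam)) i"]
  show "part (conjugate_partition (conjugate_partition lam)) i = part lam i"
    by (metis le_antisym le_refl less_one not_le zero_le)
qed (rule assms)

section \<open>The parts after adding or removing one border strip\<close>

lemma outside_border_iff:
  assumes "is_partition mu" "2 \<le> i"
  shows "(i, j) \<in> outside_border mu \<longleftrightarrow>
    i \<le> Suc (length mu) \<and> part mu i < j \<and> j \<le> Suc (part mu (i - 1))"
proof -
  have "part mu 0 = 0" by (simp add: part_def)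
  moreover have "i - 1 \<le> length mu \<longleftrightarrow> 0 < part mu (i - 1)"
    using part_pos_iff[OF assms(1), of "i - 1"] assms(2) by auto
  ultimately show ?thesis
    using assms(2) unfolding outside_border_def
    by (cases "j = 1") (auto simp: diagram_iff)
qed

lemma inside_border_iff:
  "(i, j) \<in> inside_border mu \<longleftrightarrow> 1 \<le> i \<and> 1 \<le> j \<and> part mu (Suc i) \<le> j \<and> j \<le> part mu i"
  unfolding inside_border_def by (auto simp: diagram_iff)

text \<open>The outside border of row \<open>i\<close> ends at column
  \<open>Suc (part mu (i - 1))\<close>, and the strip fills each row up to there, except that in its
  first row it starts at \<open>part mu a\<close>. In \<open>S_minor\<close>, each row from
  \<open>a + 2\<close> to \<open>b + 1\<close> thereby takes over the column of the row above it, so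
  that the set of columns changes in one element only. The assumption on \<open>a\<close> puts the
  first cell outside the diagram, and \<open>b \<le> length mu\<close> makes the border reach row
  \<open>b + 1\<close>.\<close>

lemma add_strip:
  assumes mu: "is_partition mu" and ab: "1 \<le> a" "a \<le> b" "b \<le> length mu"
    and a: "part mu (Suc a) < part mu a"
  shows is_partition_add_strip:
      "is_partition (add_strip (Suc a, part mu a) (Suc b, Suc (part mu (Suc b))) mu)" (is ?A)
    and part_add_strip: "\<And>i. 1 \<le> i \<Longrightarrow>
      part (add_strip (Suc a, part mu a) (Suc b, Suc (part mu (Suc b))) mu) i =
      (if i = Suc a then part mu a else if a < i \<and> i \<le> Suc b then Suc (part mu (i - 1))
       else part mu i)" (is "\<And>i. _ \<Longrightarrow> part ?nu i = ?f i")
proof -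
  let ?D = "diagram mu \<union> {c \<in> outside_border mu.
    strip_le (Suc a, part mu a) c \<and> strip_le c (Suc b, Suc (part mu (Suc b)))}"
  note anti = part_antimono[OF mu]
  have mono: "?f (Suc i) \<le> ?f i" if i: "1 \<le> i" for i
  proof -
    have "part mu i \<le> part mu (i - 1)" if "a < i" using anti[of "i - 1" i] that ab by auto
    moreover have "part mu (Suc i) \<le> part mu a" if "a \<le> i" using anti[of a "Suc i"] that ab by auto
    ultimately show ?thesis using anti[of i "Suc i"] i a ab by auto
  qed
  have zero: "?f i = 0" if "Suc (length mu) < i" for i
    using that ab by (auto simp: part_eq_0)
  have D: "(i, j) \<in> ?D \<longleftrightarrow> 1 \<le> i \<and> 1 \<le> j \<and> j \<le> ?f i" for i j
  proof (cases "2 \<le> i")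
    case False
    then show ?thesis using ab by (auto simp: diagram_iff strip_le_def outside_border_def)
  next
    case True
    then have "1 \<le> i - 1" by linarith
    then have prev: "part mu i \<le> part mu (i - 1)" by (rule anti) simp
    consider "i \<le> a" | "i = Suc a" | "Suc a < i" "i \<le> b" | "Suc a < i" "i = Suc b" | "Suc b < i"
      by linarith
    then show ?thesis
    proof cases
      case 2
      have "Suc a = Suc b \<Longrightarrow> part mu (Suc b) < j \<longleftrightarrow> part mu (Suc a) < j" by simp
      with 2 show ?thesis
        using True ab a outside_border_iff[OF mu True, of j]
        by (auto simp: diagram_iff strip_le_def)
    next
      case 3
      then show ?thesis
        using True ab outside_border_iff[OF mu True, of j] prev
        by (auto simp: diagram_iff strip_le_def)
    next
      case 4
      then show ?thesis
        using True ab outside_border_iff[OF mu True, of j] prev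
        by (auto simp: diagram_iff strip_le_def)
    qed (use True ab outside_border_iff[OF mu True, of j] in \<open>auto simp: diagram_iff strip_le_def\<close>)
  qed
  show ?A unfolding add_strip_def
    by (rule partition_of_diagram_parts(1)[of ?f "Suc (length mu)"])
      (erule mono, erule zero, rule D)
  show "part ?nu i = ?f i" if "1 \<le> i" for i unfolding add_strip_def
    by (rule partition_of_diagram_parts(2)[of ?f "Suc (length mu)", OF _ _ _ that])
      (erule mono, erule zero, rule D)
qed

text \<open>The inside border of row \<open>i\<close> begins at column
  \<open>part mu (Suc i)\<close>, which is cut off in every row above the last; in row
  \<open>b\<close> the strip stops one cell earlier. Each row from \<open>a\<close> to
  \<open>b - 1\<close> thereby takes over the column of the row below it. The assumption on
  \<open>b\<close> puts the last cell inside the diagram.\<close>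

lemma rem_strip:
  assumes mu: "is_partition mu" and ab: "1 \<le> a" "a \<le> b"
    and b: "part mu (Suc b) < part mu b"
  shows is_partition_rem_strip:
      "is_partition (rem_strip (a, part mu a) (b, Suc (part mu (Suc b))) mu)" (is ?A)
    and part_rem_strip: "\<And>i. 1 \<le> i \<Longrightarrow>
      part (rem_strip (a, part mu a) (b, Suc (part mu (Suc b))) mu) i =
      (if i = b then part mu (Suc b) else if a \<le> i \<and> i < b then part mu (Suc i) - 1
       else part mu i)" (is "\<And>i. _ \<Longrightarrow> part ?nu i = ?f i")
proof -
  let ?D = "diagram mu - {c \<in> inside_border mu.
    strip_le (a, part mu a) c \<and> strip_le c (b, Suc (part mu (Suc b)))}"
  note anti = part_antimono[OF mu]
  have mono: "?f (Suc i) \<le> ?f i" if i: "1 \<le> i" for i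
    using anti[of i "Suc i"] anti[of "Suc i" "Suc (Suc i)"] i b ab by auto
  have zero: "?f i = 0" if "length mu < i" for i
    using that by (auto simp: part_eq_0)
  have D: "(i, j) \<in> ?D \<longleftrightarrow> 1 \<le> i \<and> 1 \<le> j \<and> j \<le> ?f i" for i j
  proof -
    consider "i < a" | "a \<le> i" "i < b" | "i = b" | "b < i" by linarith
    then show ?thesis
    proof cases
      case 2
      then have "0 < part mu (Suc i)" using anti[of "Suc i" b] b by simp
      with 2 show ?thesis
        using ab anti[of i "Suc i"] by (auto simp: diagram_iff strip_le_def inside_border_iff)
    next
      case 3
      then show ?thesis
        using ab b by (auto simp: diagram_iff strip_le_def inside_border_iff)
    qed (use ab in \<open>auto simp: diagram_iff strip_le_def inside_border_iff\<close>)
  qed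
  show ?A unfolding rem_strip_def
    by (rule partition_of_diagram_parts(1)[of ?f "length mu"])
      (erule mono, erule zero, rule D)
  show "part ?nu i = ?f i" if "1 \<le> i" for i unfolding rem_strip_def
    by (rule partition_of_diagram_parts(2)[of ?f "length mu", OF _ _ _ that])
      (erule mono, erule zero, rule D)
qed

section \<open>The parts of \<open>sub_first\<close> and \<open>add_first\<close>\<close>

lemma part_Cons: "part (x # xs) i = (if i = 0 then 0 else if i = 1 then x else part xs (i - 1))"
  by (auto simp: part_def nth_Cons')

text \<open>In a weakly decreasing list the zeros stand at the end, so dropping them shifts no other
  part.\<close>

lemma part_filter_pos:
  assumes "sorted_wrt (\<ge>) xs"
  shows "part (filter (\<lambda>x. 0 < x) xs) i = part xs i"
  using assms
proof (induction xs arbitrary: i)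
  case (Cons x xs)
  show ?case
  proof (cases "x = 0")
    case True
    then have 0: "\<forall>y\<in>set (x # xs). y = 0" using Cons.prems by auto
    then have "filter (\<lambda>x. 0 < x) (x # xs) = []" by (simp add: filter_empty_conv)
    moreover have "part (x # xs) i = 0" using 0 nth_mem[of "i - 1" "x # xs"] by (auto simp: part_def)
    ultimately show ?thesis by (simp add: part_def)
  next
    case False
    then show ?thesis using Cons by (simp add: part_Cons)
  qed
qed simp

lemma sub_first_1:
  assumes "is_partition lam" "1 \<le> l" "l \<le> length lam" "part lam (Suc l) < part lam l"
  shows is_partition_sub_first: "is_partition (sub_first 1 l lam)"
    and part_sub_first: "part (sub_first 1 l lam) i = part lam i - (if i \<le> l then 1 else 0)"
proof -
  let ?xs = "map (\<lambda>x. x - 1) (take l lam) @ drop l lam"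
  have len: "length ?xs = length lam" by simp
  have nth: "?xs ! k = (if k < l then lam ! k - 1 else lam ! k)" if "k < length lam" for k
    using that assms(3) by (auto simp: nth_append)
  have sorted: "sorted_wrt (\<ge>) ?xs"
    unfolding sorted_wrt_iff_nth_less len
  proof (intro allI impI)
    fix i j assume ij: "i < j" "j < length lam"
    have "part lam (Suc j) \<le> part lam (Suc i)" using ij by (intro part_antimono assms) auto
    moreover have "part lam (Suc j) < part lam (Suc i)" if "i < l" "l \<le> j"
      using part_antimono[OF assms(1), of "Suc l" "Suc j"] part_antimono[OF assms(1), of "Suc i" l]
        that assms(4) by simp
    ultimately show "?xs ! j \<le> ?xs ! i"
      using ij nth[of i] nth[of j] by (auto simp: part_def)
  qed
  show "part (sub_first 1 l lam) i = part lam i - (if i \<le> l then 1 else 0)"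
    unfolding sub_first_def part_filter_pos[OF sorted]
    using nth[of "i - 1"] len by (auto simp: part_def)
  show "is_partition (sub_first 1 l lam)"
    using sorted_wrt_filter[OF sorted] unfolding is_partition_def sub_first_def by simp
qed

lemma add_first_1:
  assumes "is_partition lam" "l \<le> length lam"
  shows is_partition_add_first: "is_partition (add_first 1 l lam)"
    and part_add_first: "1 \<le> i \<Longrightarrow> part (add_first 1 l lam) i = part lam i + (if i \<le> l then 1 else 0)"
proof -
  let ?xs = "map (\<lambda>x. x + 1) (take l lam) @ drop l lam"
  have len: "length ?xs = length lam" by simp
  have nth: "?xs ! k = (if k < l then lam ! k + 1 else lam ! k)" if "k < length lam" for k
    using that assms(2) by (auto simp: nth_append)
  have "sorted_wrt (\<ge>) ?xs"
    unfolding sorted_wrt_iff_nth_less len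
  proof (intro allI impI)
    fix i j assume ij: "i < j" "j < length lam"
    have "part lam (Suc j) \<le> part lam (Suc i)" using ij by (intro part_antimono assms) auto
    then show "?xs ! j \<le> ?xs ! i"
      using ij nth[of i] nth[of j] by (auto simp: part_def)
  qed
  moreover have "0 \<notin> set ?xs"
    using assms(1) by (auto simp: is_partition_def dest: in_set_dropD)
  ultimately show "is_partition (add_first 1 l lam)"
    by (simp add: is_partition_def add_first_def)
  show "part (add_first 1 l lam) i = part lam i + (if i \<le> l then 1 else 0)" if "1 \<le> i"
    unfolding add_first_def using nth[of "i - 1"] len that assms(2) by (auto simp: part_def)
qed

section \<open>Corners as descents of the sequence of parts\<close>

definition corner_rows :: "nat list \<Rightarrow> nat set" where
  "corner_rows lam = {i. 1 \<le> i \<and> part lam (Suc i) < part lam i}"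

lemma corners_eq: "corners lam = (\<lambda>i. (i, part lam i)) ` corner_rows lam"
  by (auto simp: corners_def diagram_iff corner_rows_def)

lemma fst_corners: "fst ` corners lam = corner_rows lam"
  by (simp add: corners_eq image_image)

lemma finite_corner_rows: "finite (corner_rows lam)"
  by (rule finite_subset[of _ "{..length lam}"]) (auto simp: corner_rows_def part_def)

lemma card_corners: "card (corners lam) = card (corner_rows lam)"
  unfolding corners_eq by (intro card_image) (auto simp: inj_on_def)

lemma corner_row_bij: "bij_betw (corner_row lam) {1..card (corners lam)} (corner_rows lam)"
proof -
  let ?xs = "sorted_list_of_set (corner_rows lam)"
  have "bij_betw ((!) ?xs \<circ> (\<lambda>i. i - 1)) {1..card (corners lam)} (corner_rows lam)"
  proof (rule bij_betw_trans)
    show "bij_betw (\<lambda>i. i - 1) {1..card (corners lam)} {..<card (corners lam)}"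
      by (rule bij_betw_byWitness[of _ Suc]) auto
    show "bij_betw ((!) ?xs) {..<card (corners lam)} (corner_rows lam)"
      by (rule bij_betw_nth) (use finite_corner_rows in \<open>auto simp: card_corners\<close>)
  qed
  then show ?thesis by (simp add: corner_row_def[abs_def] fst_corners comp_def)
qed

lemma corner_row_less:
  assumes "1 \<le> p" "p < q" "q \<le> card (corners lam)"
  shows "corner_row lam p < corner_row lam q"
  unfolding corner_row_def fst_corners
  using assms finite_corner_rows[of lam]
  by (intro sorted_wrt_nth_less[OF strict_sorted_list_of_set]) (auto simp: card_corners)

lemma corner_col_eq: "1 \<le> p \<Longrightarrow> p \<le> card (corners lam) \<Longrightarrow> corner_col lam p = part lam (corner_row lam p)"
  by (simp add: corner_col_def)

lemma part_eq_between:
  assumes lam: "is_partition lam" and "1 \<le> a" "a \<le> b" "corner_rows lam \<inter> {a..<b} = {}"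
  shows "part lam a = part lam b"
  using assms(3,4)
proof (induction rule: dec_induct)
  case (step k)
  have "k \<notin> corner_rows lam" using step by auto
  then have "part lam (Suc k) = part lam k"
    using assms(2) step part_antimono[OF lam, of k "Suc k"] by (auto simp: corner_rows_def)
  moreover have "corner_rows lam \<inter> {a..<k} = {}" using step.prems by auto
  ultimately show ?case using step.IH by simp
qed simp

text \<open>Parts are constant between consecutive corner rows, and zero after the last one. Hence
  the ends of the strips can be read off the corner rows alone, and the convention that
  \<open>corner_col\<close> is 0 after the last corner fits in.\<close>

lemma corner_col_Suc:
  assumes lam: "is_partition lam" and q: "1 \<le> q" "q \<le> card (corners lam)"
  shows "corner_col lam (Suc q) = part lam (Suc (corner_row lam q))"
proof -
  have surj: "\<exists>c\<in>{1..card (corners lam)}. i = corner_row lam c" if "i \<in> corner_rows lam" for i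
    using bij_betw_imp_surj_on[OF corner_row_bij, of lam] that by blast
  have less: "c < c'" if "corner_row lam c < corner_row lam c'" "c \<in> {1..card (corners lam)}"
    "c' \<in> {1..card (corners lam)}" for c c'
    using corner_row_less[of c' c lam] that by (cases c c' rule: linorder_cases) auto
  show ?thesis
  proof (cases "q < card (corners lam)")
    case True
    have "corner_rows lam \<inter> {Suc (corner_row lam q)..<corner_row lam (Suc q)} = {}"
    proof (rule ccontr)
      assume "corner_rows lam \<inter> {Suc (corner_row lam q)..<corner_row lam (Suc q)} \<noteq> {}"
      then obtain c where c: "c \<in> {1..card (corners lam)}"
        "corner_row lam q < corner_row lam c" "corner_row lam c < corner_row lam (Suc q)"
        using surj by fastforce
      then show False using less[of q c] less[of c "Suc q"] q True by auto
    qed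
    then show ?thesis
      using part_eq_between[OF lam, of "Suc (corner_row lam q)" "corner_row lam (Suc q)"]
        corner_row_less[of q "Suc q" lam] q True by (simp add: corner_col_eq)
  next
    case False
    \<comment> \<open>A row that lies beyond all parts and also beyond the corner row, so that its
      part is 0.\<close>
    let ?m = "max (Suc (length lam)) (Suc (corner_row lam q))"
    have "corner_rows lam \<inter> {Suc (corner_row lam q)..<?m} = {}"
    proof (rule ccontr)
      assume "corner_rows lam \<inter> {Suc (corner_row lam q)..<?m} \<noteq> {}"
      then obtain c where c: "c \<in> {1..card (corners lam)}" "corner_row lam q < corner_row lam c"
        using surj by fastforce
      then show False using less[of q c] q False by auto
    qed
    then show ?thesis
      using part_eq_between[OF lam, of "Suc (corner_row lam q)" ?m] False
      by (simp add: corner_col_def part_eq_0)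
  qed
qed

section \<open>Adding and removing nested strips\<close>

text \<open>The 0-based column attached to row \<open>k + 1\<close> of \<open>mu\<close> in \<open>S_minor\<close>; columns are thus listed in
  decreasing order.\<close>

definition beta :: "nat \<Rightarrow> nat list \<Rightarrow> nat \<Rightarrow> nat" where
  "beta r mu k = part mu (Suc k) + (r - Suc k)"

section \<open>Cycles of consecutive positions\<close>

lemma exists_cycle_up:
  fixes lo hi :: nat
  assumes "lo \<le> hi"
  shows "\<exists>c. c permutes {lo..hi} \<and> signof c = ((-1) ^ (hi - lo) :: int) \<and>
    (\<forall>k. lo \<le> k \<longrightarrow> k < hi \<longrightarrow> c k = Suc k) \<and> c hi = lo"
  using assms
proof (induction rule: dec_induct)
  case base
  show ?case by (rule exI[of _ id]) (simp add: permutes_id[unfolded id_def])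
next
  case (step hi)
  then obtain c where c: "c permutes {lo..hi}" "signof c = ((-1) ^ (hi - lo) :: int)"
    "\<And>k. lo \<le> k \<Longrightarrow> k < hi \<Longrightarrow> c k = Suc k" "c hi = lo" by auto
  let ?t = "Transposition.transpose lo (Suc hi)"
  have t: "?t permutes {lo..Suc hi}" using step by (intro permutes_swap_id) auto
  have c': "c permutes {lo..Suc hi}" by (rule permutes_subset[OF c(1)]) auto
  have last: "c (Suc hi) = Suc hi" using permutes_not_in[OF c(1)] by simp
  show ?case
  proof (intro exI[of _ "?t \<circ> c"] conjI allI impI)
    show "?t \<circ> c permutes {lo..Suc hi}" by (rule permutes_compose[OF c' t])
    show "signof (?t \<circ> c) = ((-1) ^ (Suc hi - lo) :: int)"
      using sign_compose[OF permutes_imp_permutation[OF _ t] permutes_imp_permutation[OF _ c']]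
        step c(2) by (simp add: sign_swap_id Suc_diff_le)
    fix k assume "lo \<le> k" "k < Suc hi"
    then show "(?t \<circ> c) k = Suc k"
      using c(3)[of k] c(4) by (cases "k = hi") auto
  qed (simp add: last)
qed

lemma exists_cycle_down:
  fixes lo hi :: nat
  assumes "lo \<le> hi"
  shows "\<exists>c. c permutes {lo..hi} \<and> signof c = ((-1) ^ (hi - lo) :: int) \<and>
    (\<forall>k. lo < k \<longrightarrow> k \<le> hi \<longrightarrow> c k = k - 1) \<and> c lo = hi"
  using assms
proof (induction rule: dec_induct)
  case base
  show ?case by (rule exI[of _ id]) (simp add: permutes_id[unfolded id_def])
next
  case (step hi)
  then obtain c where c: "c permutes {lo..hi}" "signof c = ((-1) ^ (hi - lo) :: int)"
    "\<And>k. lo < k \<Longrightarrow> k \<le> hi \<Longrightarrow> c k = k - 1" "c lo = hi" by auto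
  let ?t = "Transposition.transpose hi (Suc hi)"
  have t: "?t permutes {lo..Suc hi}" using step by (intro permutes_swap_id) auto
  have c': "c permutes {lo..Suc hi}" by (rule permutes_subset[OF c(1)]) auto
  have last: "c (Suc hi) = Suc hi" using permutes_not_in[OF c(1)] by simp
  show ?case
  proof (intro exI[of _ "?t \<circ> c"] conjI allI impI)
    show "?t \<circ> c permutes {lo..Suc hi}" by (rule permutes_compose[OF c' t])
    show "signof (?t \<circ> c) = ((-1) ^ (Suc hi - lo) :: int)"
      using sign_compose[OF permutes_imp_permutation[OF _ t] permutes_imp_permutation[OF _ c']]
        step c(2) by (simp add: sign_swap_id Suc_diff_le)
    fix k assume "lo < k" "k \<le> Suc hi"
    then show "(?t \<circ> c) k = k - 1"
      using c(3)[of k] last by (cases "k = Suc hi") auto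
  qed (simp add: c(4))
qed

text \<open>The pairs \<open>(a, b)\<close> are corner rows \<open>(r\<^sub>p, r\<^sub>q)\<close> with \<open>p \<le> d \<le> q\<close> and \<open>l = r\<^sub>d\<close>, outermost
  pair first.\<close>

definition nested_pairs :: "nat list \<Rightarrow> nat \<Rightarrow> (nat \<times> nat) list \<Rightarrow> bool" where
  "nested_pairs lam l xs \<longleftrightarrow> sorted_wrt (\<lambda>x y. fst x < fst y \<and> snd y < snd x) xs \<and>
     (\<forall>(a, b) \<in> set xs. a \<in> corner_rows lam \<and> b \<in> corner_rows lam \<and> a \<le> l \<and> l \<le> b)"

lemma nested_pairs_Cons: "nested_pairs lam l ((a, b) # xs) \<longleftrightarrow>
  a \<in> corner_rows lam \<and> b \<in> corner_rows lam \<and> a \<le> l \<and> l \<le> b \<and>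
  (\<forall>(a', b') \<in> set xs. a < a' \<and> b' < b) \<and> nested_pairs lam l xs"
  by (auto simp: nested_pairs_def)

definition add_strips :: "nat list \<Rightarrow> (nat \<times> nat) list \<Rightarrow> nat list" where
  "add_strips lam xs = foldr (\<lambda>(a, b).
     add_strip (Suc a, part lam a) (Suc b, Suc (part lam (Suc b)))) xs lam"

definition rem_strips :: "nat list \<Rightarrow> (nat \<times> nat) list \<Rightarrow> nat list" where
  "rem_strips lam xs = foldr (\<lambda>(a, b).
     rem_strip (a, part lam a) (b, Suc (part lam (Suc b)))) xs lam"

text \<open>Up to order, adding (removing) the strip of \<open>(a, b)\<close> exchanges a single column of the minor.
  The next two functions record this exchange in place; sorting the columns costs the signs
  \<open>(-1)\<^sup>b\<^sup>-\<^sup>a\<^sup>+\<^sup>1\<close> and \<open>(-1)\<^sup>b\<^sup>-\<^sup>a\<close>, hence \<open>-1\<close> for the product of the two minors.\<close>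

definition add_cols :: "nat \<Rightarrow> nat list \<Rightarrow> (nat \<times> nat) list \<Rightarrow> nat \<Rightarrow> nat" where
  "add_cols r lam xs = foldr (\<lambda>(a, b) U.
     U(a - 1 := beta (r - 1) lam (a - 1), b := beta r lam (a - 1))) xs (beta r lam)"

definition rem_cols :: "nat \<Rightarrow> nat list \<Rightarrow> (nat \<times> nat) list \<Rightarrow> nat \<Rightarrow> nat" where
  "rem_cols r lam xs = foldr (\<lambda>(a, b) W. W(a - 1 := beta r lam b)) xs (beta (r - 1) lam)"

lemma corner_rows_bounds:
  assumes "b \<in> corner_rows lam"
  shows "1 \<le> b" "b \<le> length lam" "part lam (Suc b) < part lam b"
  using assms by (auto simp: corner_rows_def part_def split: if_splits)

text \<open>The ends of a strip come from \<open>lam\<close>, but the strip is added to a partition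
  that already contains the inner strips. Strips with ends strictly between \<open>lo\<close> and
  \<open>hi\<close> alter only the rows from \<open>lo + 2\<close> to \<open>hi\<close>. So at the
  rows \<open>a\<close>, \<open>a + 1\<close> and \<open>b + 1\<close> of the next outer pair the
  parts are still those of \<open>lam\<close>, and \<open>add_strip\<close> applies. Growth of the
  parts gives \<open>b \<le> length\<close> for the current partition.\<close>

lemma add_strips_part:
  assumes "is_partition lam" "nested_pairs lam l xs"
    and "\<forall>(a, b) \<in> set xs. lo < a \<and> b < hi"
  shows "is_partition (add_strips lam xs)" (is "?P xs")
    and "\<And>i. 1 \<le> i \<Longrightarrow> i \<le> Suc lo \<or> Suc hi \<le> i \<Longrightarrow> part (add_strips lam xs) i = part lam i"
    and "\<And>i. 1 \<le> i \<Longrightarrow> part lam i \<le> part (add_strips lam xs) i"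
proof -
  have "?P xs \<and> (\<forall>i\<ge>1. i \<le> Suc lo \<or> Suc hi \<le> i \<longrightarrow> part (add_strips lam xs) i = part lam i) \<and>
    (\<forall>i\<ge>1. part lam i \<le> part (add_strips lam xs) i)"
    using assms(2,3)
  proof (induction xs arbitrary: lo hi)
    case Nil
    then show ?case using assms(1) by (simp add: add_strips_def)
  next
    case (Cons x xs)
    obtain a b where x: "x = (a, b)" by force
    let ?mu = "add_strips lam xs"
    from Cons.prems x have ab: "a \<in> corner_rows lam" "b \<in> corner_rows lam" "a \<le> b"
      and inner: "nested_pairs lam l xs" "\<forall>(a', b') \<in> set xs. a < a' \<and> b' < b"
      and lohi: "lo < a" "b < hi"
      by (auto simp: nested_pairs_Cons)
    from Cons.IH[OF inner] have mu: "is_partition ?mu"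
      "\<And>i. 1 \<le> i \<Longrightarrow> i \<le> Suc a \<or> Suc b \<le> i \<Longrightarrow> part ?mu i = part lam i"
      "\<And>i. 1 \<le> i \<Longrightarrow> part lam i \<le> part ?mu i" by auto
    note bds = corner_rows_bounds[OF ab(1)] corner_rows_bounds[OF ab(2)]
    have eqs: "part ?mu a = part lam a" "part ?mu (Suc a) = part lam (Suc a)"
      "part ?mu (Suc b) = part lam (Suc b)"
      using mu(2)[of a] mu(2)[of "Suc a"] mu(2)[of "Suc b"] bds by auto
    have "0 < part ?mu b" using mu(3)[of b] bds by simp
    then have bl: "b \<le> length ?mu" using part_pos_iff[OF mu(1)] by simp
    have new: "add_strips lam (x # xs) =
        add_strip (Suc a, part ?mu a) (Suc b, Suc (part ?mu (Suc b))) ?mu"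
      unfolding eqs by (simp add: add_strips_def x)
    have a: "part ?mu (Suc a) < part ?mu a" using eqs bds by simp
    note nw = is_partition_add_strip[OF mu(1) bds(1) ab(3) bl a]
      part_add_strip[OF mu(1) bds(1) ab(3) bl a]
    have "part lam i \<le> part (add_strips lam (x # xs)) i" if i: "1 \<le> i" for i
    proof -
      have "part lam i \<le> part lam (i - 1)" "part lam (i - 1) \<le> part ?mu (i - 1)" if "a < i"
        using part_antimono[OF assms(1), of "i - 1" i] mu(3)[of "i - 1"] that bds by auto
      moreover have "part lam (Suc a) \<le> part lam a" using bds by simp
      ultimately show ?thesis
        using mu(3)[OF i] eqs unfolding new nw(2)[OF i] by auto
    qed
    moreover have "part (add_strips lam (x # xs)) i = part lam i"
      if i: "1 \<le> i" "i \<le> Suc lo \<or> Suc hi \<le> i" for i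
      using mu(2)[OF i(1)] i lohi ab(3) unfolding new nw(2)[OF i(1)] by auto
    ultimately show ?case using nw(1) new by auto
  qed
  then show "?P xs" "\<And>i. 1 \<le> i \<Longrightarrow> i \<le> Suc lo \<or> Suc hi \<le> i \<Longrightarrow> part (add_strips lam xs) i = part lam i"
    "\<And>i. 1 \<le> i \<Longrightarrow> part lam i \<le> part (add_strips lam xs) i" by auto
qed

text \<open>The strip removed for \<open>(a, b)\<close> alters the rows from \<open>a\<close> to
  \<open>b\<close>, while the one added alters those from \<open>a + 1\<close> to
  \<open>b + 1\<close>. This accounts for the different ranges in the second conclusion of the two
  lemmas.\<close>

lemma rem_strips_part:
  assumes "is_partition lam" "nested_pairs lam l xs"
    and "\<forall>(a, b) \<in> set xs. lo < a \<and> b < hi"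
  shows "is_partition (rem_strips lam xs)" (is "?P xs")
    and "\<And>i. 1 \<le> i \<Longrightarrow> i \<le> lo \<or> hi \<le> i \<Longrightarrow> part (rem_strips lam xs) i = part lam i"
    and "\<And>i. 1 \<le> i \<Longrightarrow> part (rem_strips lam xs) i \<le> part lam i"
proof -
  have "?P xs \<and> (\<forall>i\<ge>1. i \<le> lo \<or> hi \<le> i \<longrightarrow> part (rem_strips lam xs) i = part lam i) \<and>
    (\<forall>i\<ge>1. part (rem_strips lam xs) i \<le> part lam i)"
    using assms(2,3)
  proof (induction xs arbitrary: lo hi)
    case Nil
    then show ?case using assms(1) by (simp add: rem_strips_def)
  next
    case (Cons x xs)
    obtain a b where x: "x = (a, b)" by force
    let ?mu = "rem_strips lam xs"
    from Cons.prems x have ab: "a \<in> corner_rows lam" "b \<in> corner_rows lam" "a \<le> b"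
      and inner: "nested_pairs lam l xs" "\<forall>(a', b') \<in> set xs. a < a' \<and> b' < b"
      and lohi: "lo < a" "b < hi"
      by (auto simp: nested_pairs_Cons)
    from Cons.IH[OF inner] have mu: "is_partition ?mu"
      "\<And>i. 1 \<le> i \<Longrightarrow> i \<le> a \<or> b \<le> i \<Longrightarrow> part ?mu i = part lam i"
      "\<And>i. 1 \<le> i \<Longrightarrow> part ?mu i \<le> part lam i" by auto
    note bds = corner_rows_bounds[OF ab(1)] corner_rows_bounds[OF ab(2)]
    have eqs: "part ?mu a = part lam a" "part ?mu b = part lam b"
      "part ?mu (Suc b) = part lam (Suc b)"
      using mu(2)[of a] mu(2)[of b] mu(2)[of "Suc b"] bds by auto
    have new: "rem_strips lam (x # xs) =
        rem_strip (a, part ?mu a) (b, Suc (part ?mu (Suc b))) ?mu"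
      unfolding eqs by (simp add: rem_strips_def x)
    have b: "part ?mu (Suc b) < part ?mu b" using eqs bds by simp
    note nw = is_partition_rem_strip[OF mu(1) bds(1) ab(3) b]
      part_rem_strip[OF mu(1) bds(1) ab(3) b]
    have "part (rem_strips lam (x # xs)) i \<le> part lam i" if i: "1 \<le> i" for i
      using mu(3)[OF i] mu(3)[of "Suc i"] part_antimono[OF assms(1) i, of "Suc i"] eqs bds
      unfolding new nw(2)[OF i] by auto
    moreover have "part (rem_strips lam (x # xs)) i = part lam i"
      if i: "1 \<le> i" "i \<le> lo \<or> hi \<le> i" for i
      using mu(2)[OF i(1)] i lohi ab(3) unfolding new nw(2)[OF i(1)] by auto
    ultimately show ?case using nw(1) new by auto
  qed
  then show "?P xs" "\<And>i. 1 \<le> i \<Longrightarrow> i \<le> lo \<or> hi \<le> i \<Longrightarrow> part (rem_strips lam xs) i = part lam i"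
    "\<And>i. 1 \<le> i \<Longrightarrow> part (rem_strips lam xs) i \<le> part lam i" by auto
qed

text \<open>Relative to the order of the enlarged partition, the in-place exchange for
  \<open>(a, b)\<close> is off by the cycle that moves each position from \<open>a - 1\<close> to
  \<open>b - 1\<close> up by one and sends \<open>b\<close> to \<open>a - 1\<close>. It has length
  \<open>b - a + 2\<close>. The inner strips permute only the positions from \<open>a\<close> to
  \<open>b - 1\<close>, so the two positions overwritten for \<open>(a, b)\<close> are fixed by
  their permutation.\<close>

lemma add_cols_sorting:
  assumes lam: "is_partition lam" "length lam < r" and "nested_pairs lam l xs"
    and "\<forall>(a, b) \<in> set xs. lo < a \<and> b < hi"
  shows "\<exists>p. p permutes {lo..<hi} \<and>
    signof p = ((-1) ^ (sum_list (map (\<lambda>(a, b). b - a) xs) + length xs) :: int) \<and>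
    (\<forall>k<r. add_cols r lam xs k = beta r (add_strips lam xs) (p k))"
  using assms(3,4)
proof (induction xs arbitrary: lo hi)
  case Nil
  show ?case
    by (rule exI[of _ id]) (simp add: permutes_id[unfolded id_def] add_cols_def add_strips_def)
next
  case (Cons x xs)
  obtain a b where x: "x = (a, b)" by force
  let ?mu = "add_strips lam xs" and ?nu = "add_strips lam (x # xs)"
  from Cons.prems x have ab: "a \<in> corner_rows lam" "b \<in> corner_rows lam" "a \<le> b"
    and inner: "nested_pairs lam l xs" "\<forall>(a', b') \<in> set xs. a < a' \<and> b' < b"
    and lohi: "lo < a" "b < hi"
    by (auto simp: nested_pairs_Cons)
  from Cons.IH[OF inner] obtain p where p: "p permutes {a..<b}"
    "signof p = ((-1) ^ (sum_list (map (\<lambda>(a, b). b - a) xs) + length xs) :: int)"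
    "\<And>k. k < r \<Longrightarrow> add_cols r lam xs k = beta r ?mu (p k)" by blast
  note mu = add_strips_part[OF lam(1) inner]
  note bds = corner_rows_bounds[OF ab(1)] corner_rows_bounds[OF ab(2)]
  have eqs: "part ?mu a = part lam a" "part ?mu (Suc a) = part lam (Suc a)"
    "part ?mu (Suc b) = part lam (Suc b)"
    using mu(2)[of a] mu(2)[of "Suc a"] mu(2)[of "Suc b"] bds by auto
  have "0 < part ?mu b" using mu(3)[of b] bds by simp
  then have bl: "b \<le> length ?mu" using part_pos_iff[OF mu(1)] by simp
  have new: "?nu = add_strip (Suc a, part ?mu a) (Suc b, Suc (part ?mu (Suc b))) ?mu"
    unfolding eqs by (simp add: add_strips_def x)
  have a: "part ?mu (Suc a) < part ?mu a" using eqs bds by simp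
  note nw = part_add_strip[OF mu(1) bds(1) ab(3) bl a, folded new]
  obtain c where c: "c permutes {a - 1..b}" "signof c = ((-1) ^ (b - (a - 1)) :: int)"
    "\<And>k. a - 1 \<le> k \<Longrightarrow> k < b \<Longrightarrow> c k = Suc k" "c b = a - 1"
    using exists_cycle_up[of "a - 1" b, OF le_trans[OF diff_le_self ab(3)]] by blast
  have c': "c permutes {lo..<hi}" by (rule permutes_subset[OF c(1)]) (use lohi in auto)
  have p': "p permutes {lo..<hi}" by (rule permutes_subset[OF p(1)]) (use lohi in auto)
  have "b - (a - 1) = Suc (b - a)" using ab(3) bds by simp
  then have "sum_list (map (\<lambda>(a, b). b - a) (x # xs)) + length (x # xs) =
      (b - (a - 1)) + (sum_list (map (\<lambda>(a, b). b - a) xs) + length xs)"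
    by (simp add: x)
  moreover have "sign (c \<circ> p) = sign c * sign p"
    using sign_compose[OF permutes_imp_permutation[OF _ c'] permutes_imp_permutation[OF _ p']]
    by simp
  ultimately have "signof (c \<circ> p) =
      ((-1) ^ (sum_list (map (\<lambda>(a, b). b - a) (x # xs)) + length (x # xs)) :: int)"
    using c(2) p(2) by (simp only: of_int_eq_id id_apply power_add)
  moreover have "add_cols r lam (x # xs) k = beta r ?nu ((c \<circ> p) k)" if k: "k < r" for k
  proof -
    have cols: "add_cols r lam (x # xs) k = (if k = b then beta r lam (a - 1)
        else if k = a - 1 then beta (r - 1) lam (a - 1) else beta r ?mu (p k))"
      using p(3)[OF k] by (simp add: add_cols_def x)
    have pab: "p b = b" "p (a - 1) = a - 1"
      using permutes_not_in[OF p(1)] bds ab by auto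
    have step: "beta r ?mu j = beta r ?nu (c j)" if j: "j < r" "j \<noteq> b" "j \<noteq> a - 1" for j
    proof (cases "a \<le> j \<and> j < b")
      case True
      then have "a - 1 \<le> j" "j < b" by linarith+
      then have "c j = Suc j" by (rule c(3))
      moreover have "Suc (Suc j) \<le> r" using \<open>j < b\<close> bds lam(2) by linarith
      then obtain m where "r = Suc (Suc j) + m" using le_Suc_ex by blast
      ultimately show ?thesis
        using nw[of "Suc (Suc j)"] True by (simp add: beta_def)
    next
      case False
      then have "\<not> (a - 1 \<le> j \<and> j \<le> b)" using j bds by linarith
      then have "c j = j" using permutes_not_in[OF c(1), of j] by simp
      then show ?thesis using nw[of "Suc j"] False j bds ab by (auto simp: beta_def)
    qed
    consider "k = b" | "k = a - 1" "k \<noteq> b" | "k \<noteq> b" "k \<noteq> a - 1" by blast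
    then show ?thesis
    proof cases
      case 1
      then show ?thesis
        unfolding cols using nw[of a] bds eqs c(4) pab by (simp add: beta_def)
    next
      case 2
      then show ?thesis
        unfolding cols using nw[of "Suc a"] bds ab eqs c(3)[of "a - 1"] pab lam(2)
        by (simp add: beta_def)
    next
      case 3
      have "p k \<noteq> b" "p k \<noteq> a - 1"
        using 3 pab permutes_inj[OF p(1)] by (metis injD)+
      moreover have "p k < r"
        using permutes_in_image[OF p(1), of k] permutes_not_in[OF p(1), of k] bds lam(2) k
        by (cases "k \<in> {a..<b}") auto
      ultimately show ?thesis unfolding cols using step[of "p k"] 3 by simp
    qed
  qed
  ultimately show ?case
    using permutes_compose[OF p' c'] by blast
qed

text \<open>Here the new column \<open>beta r lam b\<close> belongs at position \<open>b - 1\<close>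
  but is stored at \<open>a - 1\<close>. The correcting cycle runs through the positions from
  \<open>a - 1\<close> to \<open>b - 1\<close> and has length \<open>b - a + 1\<close>, one less
  than for the added strip.\<close>

lemma rem_cols_sorting:
  assumes lam: "is_partition lam" "length lam < r" and "nested_pairs lam l xs"
    and "\<forall>(a, b) \<in> set xs. lo < a \<and> b < hi"
  shows "\<exists>p. p permutes {lo..<hi - 1} \<and>
    signof p = ((-1) ^ (sum_list (map (\<lambda>(a, b). b - a) xs)) :: int) \<and>
    (\<forall>k<r - 1. rem_cols r lam xs k = beta (r - 1) (rem_strips lam xs) (p k))"
  using assms(3,4)
proof (induction xs arbitrary: lo hi)
  case Nil
  show ?case
    by (rule exI[of _ id]) (simp add: permutes_id[unfolded id_def] rem_cols_def rem_strips_def)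
next
  case (Cons x xs)
  obtain a b where x: "x = (a, b)" by force
  let ?mu = "rem_strips lam xs" and ?nu = "rem_strips lam (x # xs)"
  from Cons.prems x have ab: "a \<in> corner_rows lam" "b \<in> corner_rows lam" "a \<le> b"
    and inner: "nested_pairs lam l xs" "\<forall>(a', b') \<in> set xs. a < a' \<and> b' < b"
    and lohi: "lo < a" "b < hi"
    by (auto simp: nested_pairs_Cons)
  from Cons.IH[OF inner] obtain p where p: "p permutes {a..<b - 1}"
    "signof p = ((-1) ^ (sum_list (map (\<lambda>(a, b). b - a) xs)) :: int)"
    "\<And>k. k < r - 1 \<Longrightarrow> rem_cols r lam xs k = beta (r - 1) ?mu (p k)" by blast
  note mu = rem_strips_part[OF lam(1) inner]
  note bds = corner_rows_bounds[OF ab(1)] corner_rows_bounds[OF ab(2)]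
  have eqs: "part ?mu a = part lam a" "part ?mu b = part lam b"
    "part ?mu (Suc b) = part lam (Suc b)"
    using mu(2)[of a] mu(2)[of b] mu(2)[of "Suc b"] bds by auto
  have new: "?nu = rem_strip (a, part ?mu a) (b, Suc (part ?mu (Suc b))) ?mu"
    unfolding eqs by (simp add: rem_strips_def x)
  have b: "part ?mu (Suc b) < part ?mu b" using eqs bds by simp
  note nw = part_rem_strip[OF mu(1) bds(1) ab(3) b, folded new]
  \<comment> \<open>Positivity up to row \<open>b\<close> ensures that the subtraction of 1 in the
    new parts is not truncated.\<close>
  have pos: "0 < part ?mu i" if "1 \<le> i" "i \<le> b" for i
    using part_antimono[OF mu(1) that] b by simp
  obtain c where c: "c permutes {a - 1..b - 1}" "signof c = ((-1) ^ (b - 1 - (a - 1)) :: int)"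
    "\<And>k. a - 1 < k \<Longrightarrow> k \<le> b - 1 \<Longrightarrow> c k = k - 1" "c (a - 1) = b - 1"
    using exists_cycle_down[of "a - 1" "b - 1", OF diff_le_mono[OF ab(3)]] by blast
  have c': "c permutes {lo..<hi - 1}" by (rule permutes_subset[OF c(1)]) (use lohi bds in auto)
  have p': "p permutes {lo..<hi - 1}" by (rule permutes_subset[OF p(1)]) (use lohi in auto)
  have "b - 1 - (a - 1) = b - a" using ab(3) bds by simp
  then have "signof (c \<circ> p) = ((-1) ^ (sum_list (map (\<lambda>(a, b). b - a) (x # xs))) :: int)"
    using sign_compose[OF permutes_imp_permutation[OF _ c'] permutes_imp_permutation[OF _ p']]
      c(2) p(2) by (simp add: x power_add)
  moreover have "rem_cols r lam (x # xs) k = beta (r - 1) ?nu ((c \<circ> p) k)" if k: "k < r - 1" for k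
  proof -
    have cols: "rem_cols r lam (x # xs) k =
        (if k = a - 1 then beta r lam b else beta (r - 1) ?mu (p k))"
      using p(3)[OF k] by (simp add: rem_cols_def x)
    have pa: "p (a - 1) = a - 1"
      using permutes_not_in[OF p(1)] bds ab by auto
    have step: "beta (r - 1) ?mu j = beta (r - 1) ?nu (c j)" if j: "j < r - 1" "j \<noteq> a - 1" for j
    proof (cases "a \<le> j \<and> j < b")
      case True
      then have "0 < part ?mu (Suc j)" by (intro pos) auto
      moreover have "c j = j - 1" "Suc (j - 1) = j" "1 \<le> j" using c(3)[of j] True bds by auto
      ultimately show ?thesis
        using nw[of j] True bds ab lam(2) by (simp add: beta_def)
    next
      case False
      then have "\<not> (a - 1 \<le> j \<and> j \<le> b - 1)" using j bds by linarith
      then have "c j = j" using permutes_not_in[OF c(1), of j] by simp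
      then show ?thesis using nw[of "Suc j"] False j bds ab by (auto simp: beta_def)
    qed
    show ?thesis
    proof (cases "k = a - 1")
      case True
      then show ?thesis
        unfolding cols using nw[of b] bds eqs c(4) pa by (simp add: beta_def)
    next
      case False
      have "p k \<noteq> a - 1"
        using False pa permutes_inj[OF p(1)] by (metis injD)
      moreover have "p k < r - 1"
        using permutes_in_image[OF p(1), of k] permutes_not_in[OF p(1), of k] bds lam(2) k
        by (cases "k \<in> {a..<b - 1}") auto
      ultimately show ?thesis unfolding cols using step[of "p k"] False by simp
    qed
  qed
  ultimately show ?case
    using permutes_compose[OF p' c'] by blast
qed

section \<open>The exchange terms\<close>

definition S_gen :: "(nat \<Rightarrow> nat \<Rightarrow> 'a) \<Rightarrow> nat \<Rightarrow> nat list \<Rightarrow> 'a :: idom" where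
  "S_gen A r lam = fdet r (\<lambda>i b. A i (part lam (r - b) + b))"

definition S_rev :: "(nat \<Rightarrow> nat \<Rightarrow> 'a) \<Rightarrow> nat \<Rightarrow> nat list \<Rightarrow> 'a :: idom" where
  "S_rev A r lam = fdet r (\<lambda>i k. A i (beta r lam k))"

lemma reverse_permutes:
  fixes r :: nat
  shows "(\<lambda>b. if b < r then r - 1 - b else b) permutes {0..<r}"
proof (rule bij_imp_permutes)
  show "bij_betw (\<lambda>b. if b < r then r - 1 - b else b) {0..<r} {0..<r}"
    by (rule bij_betw_byWitness[of _ "\<lambda>b. r - 1 - b"]) auto
qed simp

text \<open>The sign of the reversal depends on \<open>r\<close> only and so is a common factor of
  all terms of the identity. Reversed columns have the advantage that position \<open>k\<close>
  belongs to row \<open>k + 1\<close> for every size.\<close>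

lemma S_gen_eq:
  "S_gen A r lam = signof (\<lambda>b. if b < r then r - 1 - b else b) * S_rev A r lam"
proof -
  have "S_gen A r lam =
    fdet r (\<lambda>i b. A i (beta r lam ((\<lambda>b. if b < r then r - 1 - b else b) b)))"
    unfolding S_gen_def by (intro fdet_cong) (simp add: beta_def Suc_diff_Suc)
  also have "\<dots> = signof (\<lambda>b. if b < r then r - 1 - b else b) * S_rev A r lam"
    unfolding S_rev_def by (rule fdet_permute_cols[OF reverse_permutes])
  finally show ?thesis .
qed

text \<open>The exchanged set that belongs to a list of strips. Positions are counted from 0: a pair
  \<open>(a, b)\<close> gives up the position of row \<open>a\<close> and acquires that of row
  \<open>b + 1\<close>, the row just below the corner in row \<open>b\<close>.\<close>

definition swap_set :: "nat \<Rightarrow> (nat \<times> nat) list \<Rightarrow> nat set" where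
  "swap_set l xs = ({..<l} - (\<lambda>x. fst x - 1) ` set xs) \<union> snd ` set xs"

text \<open>The columns of \<open>lam - (1\<^sup>l)\<close> and of \<open>lam + (1\<^sup>l)\<close>. Their first \<open>l\<close> entries are exchanged.\<close>

definition low_cols :: "nat \<Rightarrow> nat list \<Rightarrow> nat \<Rightarrow> nat \<Rightarrow> nat" where
  "low_cols r lam l k = (if k < l then beta (r - 1) lam k else beta r lam k)"

definition high_cols :: "nat \<Rightarrow> nat list \<Rightarrow> nat \<Rightarrow> nat \<Rightarrow> nat" where
  "high_cols r lam l k = (if k < l then beta r lam k else beta (r - 1) lam k)"

text \<open>\<open>\<sigma>\<close> is the identity with \<open>a - 1\<close> redirected to
  \<open>b\<close> for every pair. With this choice the exchanged columns are exactly the ones that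
  \<open>add_cols\<close> and \<open>rem_cols\<close> write in place. The last conjunct carries the
  induction: \<open>a - 1\<close> must still be fixed when the outer pair redirects it.\<close>

lemma exists_exchange_bij:
  assumes "nested_pairs lam l xs"
  shows "\<exists>\<sigma>. bij_betw \<sigma> {..<l} (swap_set l xs) \<and>
    (\<forall>k<l. add_cols r lam xs (\<sigma> k) = high_cols r lam l k) \<and>
    (\<forall>k. k \<notin> swap_set l xs \<longrightarrow> add_cols r lam xs k = low_cols r lam l k) \<and>
    (\<forall>k<l. rem_cols r lam xs k = low_cols r lam l (\<sigma> k)) \<and>
    (\<forall>k\<ge>l. rem_cols r lam xs k = high_cols r lam l k) \<and>
    (\<forall>k<l. k \<notin> (\<lambda>x. fst x - 1) ` set xs \<longrightarrow> \<sigma> k = k)"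
  using assms
proof (induction xs)
  case Nil
  show ?case
    by (rule exI[of _ "\<lambda>k. k"])
      (auto simp: swap_set_def add_cols_def rem_cols_def low_cols_def high_cols_def bij_betw_def)
next
  case (Cons x xs)
  obtain a b where x: "x = (a, b)" by force
  from Cons.prems x have ab: "a \<in> corner_rows lam" "b \<in> corner_rows lam" "a \<le> l" "l \<le> b"
    and inner: "nested_pairs lam l xs" "\<forall>(a', b') \<in> set xs. a < a' \<and> b' < b"
    by (auto simp: nested_pairs_Cons)
  from Cons.IH[OF inner(1)] obtain \<sigma> where \<sigma>: "bij_betw \<sigma> {..<l} (swap_set l xs)"
    "\<And>k. k < l \<Longrightarrow> add_cols r lam xs (\<sigma> k) = high_cols r lam l k"
    "\<And>k. k \<notin> swap_set l xs \<Longrightarrow> add_cols r lam xs k = low_cols r lam l k"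
    "\<And>k. k < l \<Longrightarrow> rem_cols r lam xs k = low_cols r lam l (\<sigma> k)"
    "\<And>k. l \<le> k \<Longrightarrow> rem_cols r lam xs k = high_cols r lam l k"
    "\<And>k. k < l \<Longrightarrow> k \<notin> (\<lambda>x. fst x - 1) ` set xs \<Longrightarrow> \<sigma> k = k" by blast
  have a1: "a - 1 < l" using ab corner_rows_bounds[OF ab(1)] by linarith
  have anot: "a - 1 \<notin> (\<lambda>x. fst x - 1) ` set xs"
  proof
    assume "a - 1 \<in> (\<lambda>x. fst x - 1) ` set xs"
    then obtain a' b' where "(a', b') \<in> set xs" "a - 1 = a' - 1" by auto
    with inner(2) corner_rows_bounds[OF ab(1)] show False by fastforce
  qed
  have bnot: "b \<notin> swap_set l xs" using inner(2) ab(4) by (auto simp: swap_set_def)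
  have \<sigma>a: "\<sigma> (a - 1) = a - 1" by (rule \<sigma>(6)[OF a1 anot])
  have set: "swap_set l (x # xs) = insert b (swap_set l xs - {a - 1})"
  proof -
    have "a - 1 \<notin> snd ` set xs"
    proof
      assume "a - 1 \<in> snd ` set xs"
      then obtain a' where "(a', a - 1) \<in> set xs" by auto
      then have "l \<le> a - 1" using inner(1) by (auto simp: nested_pairs_def)
      with a1 show False by simp
    qed
    then show ?thesis using a1 ab(4) by (auto simp: swap_set_def x)
  qed
  let ?s = "\<sigma>(a - 1 := b)"
  have inj: "inj_on \<sigma> {..<l}" and im: "\<sigma> ` {..<l} = swap_set l xs"
    using \<sigma>(1) by (auto simp: bij_betw_def)
  have ne: "\<sigma> k \<noteq> b" "\<sigma> k \<noteq> a - 1" if "k < l" "k \<noteq> a - 1" for k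
  proof -
    show "\<sigma> k \<noteq> b" using im bnot that by auto
    show "\<sigma> k \<noteq> a - 1" using inj_onD[OF inj, of k "a - 1"] \<sigma>a that a1 by auto
  qed
  have "bij_betw ?s {..<l} (swap_set l (x # xs))"
    unfolding bij_betw_def
  proof
    show "inj_on ?s {..<l}"
      using inj ne by (auto simp: inj_on_def)
    have "?s ` {..<l} = insert b (\<sigma> ` ({..<l} - {a - 1}))" using a1 by auto
    also have "\<sigma> ` ({..<l} - {a - 1}) = \<sigma> ` {..<l} - \<sigma> ` {a - 1}"
      by (rule inj_on_image_set_diff[OF inj]) (use a1 in auto)
    finally show "?s ` {..<l} = swap_set l (x # xs)" by (simp only: im set \<sigma>a image_insert image_empty)
  qed
  moreover have add: "add_cols r lam (x # xs) =
      (add_cols r lam xs)(a - 1 := beta (r - 1) lam (a - 1), b := beta r lam (a - 1))"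
    by (simp add: add_cols_def x)
  moreover have rem: "rem_cols r lam (x # xs) = (rem_cols r lam xs)(a - 1 := beta r lam b)"
    by (simp add: rem_cols_def x)
  have "add_cols r lam (x # xs) (?s k) = high_cols r lam l k" if "k < l" for k
    using \<sigma>(2)[OF that] ne[of k] that a1 by (auto simp: add high_cols_def)
  moreover have "add_cols r lam (x # xs) k = low_cols r lam l k" if "k \<notin> swap_set l (x # xs)" for k
    using \<sigma>(3)[of k] that a1 by (auto simp: add low_cols_def set)
  moreover have "rem_cols r lam (x # xs) k = low_cols r lam l (?s k)" if "k < l" for k
    using \<sigma>(4)[OF that] ab(4) by (auto simp: rem low_cols_def)
  moreover have "rem_cols r lam (x # xs) k = high_cols r lam l k" if "l \<le> k" for k
    using \<sigma>(5)[OF that] a1 that by (auto simp: rem)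
  moreover have "?s k = k" if "k < l" "k \<notin> (\<lambda>x. fst x - 1) ` set (x # xs)" for k
    using \<sigma>(6)[of k] that by (auto simp: x)
  ultimately show ?case by blast
qed

definition exchange_term ::
  "(nat \<Rightarrow> nat \<Rightarrow> 'a) \<Rightarrow> nat \<Rightarrow> nat list \<Rightarrow> nat \<Rightarrow> nat set \<Rightarrow> 'a :: idom" where
  "exchange_term A r lam l K = (-1) ^ card {..<l} *
     fdet (r + (r - 1)) (exchange_mat A r {..<l} (low_cols r lam l) (high_cols r lam l) K)"

lemma swap_set_subset:
  assumes "nested_pairs lam l xs" "length lam < r" "l \<le> length lam"
  shows "swap_set l xs \<subseteq> {..<r}"
  using assms corner_rows_bounds(2)[of _ lam] by (fastforce simp: swap_set_def nested_pairs_def)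

lemma exchange_term_swap_set:
  fixes A :: "nat \<Rightarrow> nat \<Rightarrow> 'a :: idom"
  assumes lam: "is_partition lam" "length lam < r" "l \<le> length lam" and xs: "nested_pairs lam l xs"
  shows "exchange_term A r lam l (swap_set l xs) =
    (-1) ^ length xs * (S_rev A r (add_strips lam xs) * S_rev A (r - 1) (rem_strips lam xs))"
proof -
  obtain \<sigma> where \<sigma>: "bij_betw \<sigma> {..<l} (swap_set l xs)"
    "\<And>k. k < l \<Longrightarrow> add_cols r lam xs (\<sigma> k) = high_cols r lam l k"
    "\<And>k. k \<notin> swap_set l xs \<Longrightarrow> add_cols r lam xs k = low_cols r lam l k"
    "\<And>k. k < l \<Longrightarrow> rem_cols r lam xs k = low_cols r lam l (\<sigma> k)"
    "\<And>k. l \<le> k \<Longrightarrow> rem_cols r lam xs k = high_cols r lam l k"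
    using exists_exchange_bij[OF xs, of r] by blast
  have bounds: "\<forall>(a, b) \<in> set xs. 0 < a \<and> b < r"
    using xs lam(2) corner_rows_bounds[of _ lam] by (fastforce simp: nested_pairs_def)
  let ?e = "sum_list (map (\<lambda>(a, b). b - a) xs)"
  obtain p where p: "p permutes {0..<r}" "signof p = ((-1) ^ (?e + length xs) :: int)"
    "\<And>k. k < r \<Longrightarrow> add_cols r lam xs k = beta r (add_strips lam xs) (p k)"
    using add_cols_sorting[OF lam(1,2) xs bounds] by blast
  obtain p' where p': "p' permutes {0..<r - 1}" "signof p' = ((-1) ^ ?e :: int)"
    "\<And>k. k < r - 1 \<Longrightarrow> rem_cols r lam xs k = beta (r - 1) (rem_strips lam xs) (p' k)"
    using rem_cols_sorting[OF lam(1,2) xs bounds] by blast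
  have "exchange_term A r lam l (swap_set l xs) =
    fdet r (\<lambda>i k. A i (add_cols r lam xs k)) * fdet (r - 1) (\<lambda>i k. A i (rem_cols r lam xs k))"
    unfolding exchange_term_def
    by (rule exchange_mat_bij[OF _ swap_set_subset[OF xs lam(2,3)] \<sigma>(1)])
      (use \<sigma>(2-5) lam in auto)
  also have "fdet r (\<lambda>i k. A i (add_cols r lam xs k)) =
      fdet r (\<lambda>i k. A i (beta r (add_strips lam xs) (p k)))"
    by (intro fdet_cong) (simp add: p(3))
  also have "\<dots> = (-1) ^ (?e + length xs) * S_rev A r (add_strips lam xs)"
    using fdet_permute_cols[OF p(1), of "\<lambda>i k. A i (beta r (add_strips lam xs) k)"] p(2)
    by (simp add: S_rev_def)
  also have "fdet (r - 1) (\<lambda>i k. A i (rem_cols r lam xs k)) =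
      fdet (r - 1) (\<lambda>i k. A i (beta (r - 1) (rem_strips lam xs) (p' k)))"
    by (intro fdet_cong) (simp add: p'(3))
  also have "\<dots> = (-1) ^ ?e * S_rev A (r - 1) (rem_strips lam xs)"
    using fdet_permute_cols[OF p'(1), of "\<lambda>i k. A i (beta (r - 1) (rem_strips lam xs) k)"] p'(2)
    by (simp add: S_rev_def)
  finally have "exchange_term A r lam l (swap_set l xs) =
      ((-1) ^ ?e * (-1) ^ ?e) * ((-1) ^ length xs *
      (S_rev A r (add_strips lam xs) * S_rev A (r - 1) (rem_strips lam xs)))"
    by (simp only: power_add mult_ac)
  then show ?thesis by (simp flip: power_mult_distrib)
qed

text \<open>The two corner conditions differ by one because a descent between rows
  \<open>k + 1\<close> and \<open>k + 2\<close> frees position \<open>k\<close> for leaving, whereas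
  entering position \<open>k\<close> requires a descent between rows \<open>k\<close> and
  \<open>k + 1\<close>.\<close>

definition admissible :: "nat \<Rightarrow> nat list \<Rightarrow> nat \<Rightarrow> nat set \<Rightarrow> bool" where
  "admissible r lam l K \<longleftrightarrow> K \<subseteq> {..<r} \<and> card K = l \<and>
     (\<forall>k<l. k \<notin> K \<longrightarrow> Suc k \<in> corner_rows lam) \<and> (\<forall>k\<in>K. l \<le> k \<longrightarrow> k \<in> corner_rows lam)"

text \<open>If rows \<open>k + 1\<close> and \<open>k + 2\<close> have equal parts, then
  \<open>beta (r - 1) lam k = beta r lam (Suc k)\<close>. Each violated corner condition leaves two
  such equal columns in the same block.\<close>

lemma exchange_term_not_admissible:
  assumes lam: "is_partition lam" "length lam < r" and l: "l \<in> corner_rows lam"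
    and K: "K \<subseteq> {..<r}" "\<not> admissible r lam l K"
  shows "exchange_term A r lam l K = 0"
proof -
  let ?E = "exchange_mat A r {..<l} (low_cols r lam l) (high_cols r lam l) K"
  note lb = corner_rows_bounds[OF l]
  have lr: "{..<l} \<subseteq> {..<r - 1}" using lb lam(2) by auto
  have not_corner: "part lam (Suc i) = part lam i" if "1 \<le> i" "i \<notin> corner_rows lam" for i
    using that part_antimono[OF lam(1), of i "Suc i"] by (auto simp: corner_rows_def)
  consider "card K \<noteq> l"
    | k where "k < l" "k \<notin> K" "Suc k \<notin> corner_rows lam"
    | k where "k \<in> K" "l \<le> k" "k \<notin> corner_rows lam"
    using K unfolding admissible_def by blast
  then have "fdet (r + (r - 1)) ?E = 0"
  proof cases
    case 1
    then show ?thesis by (intro exchange_mat_card_neq[OF lr K(1)]) simp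
  next
    case 2
    \<comment> \<open>As \<open>l\<close> is a corner row, \<open>Suc k\<close> differs from
      \<open>l\<close> and is again one of the first \<open>l\<close> positions. Its column from the
      second minor has moved to the upper block, where position \<open>k\<close> has stayed.\<close>
    have kl: "Suc k < l" using 2 l by (cases "Suc k = l") auto
    have eq: "part lam (Suc (Suc k)) = part lam (Suc k)" using not_corner[of "Suc k"] 2 by simp
    show ?thesis
    proof (rule fdet_identical_cols[of k _ "r + Suc k"])
      show "k < r + (r - 1)" "r + Suc k < r + (r - 1)" "k \<noteq> r + Suc k"
        using kl lb lam(2) by auto
      show "?E i k = ?E i (r + Suc k)" for i
        using 2 kl lb lam(2) eq
        by (auto simp: exchange_mat_def low_cols_def high_cols_def beta_def)
    qed
  next
    case 3
    \<comment> \<open>Dually, position \<open>k - 1\<close> of the second minor lies beyond the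
      first \<open>l\<close> and has stayed in the lower block, into which position \<open>k\<close>
      has moved.\<close>
    have kl: "l < k" using 3 l by (cases "k = l") auto
    have kr: "k < r" using 3 K by auto
    have eq: "part lam (Suc k) = part lam k" using not_corner[of k] 3 lb by simp
    show ?thesis
    proof (rule fdet_identical_cols[of k _ "r + (k - 1)"])
      show "k < r + (r - 1)" "r + (k - 1) < r + (r - 1)" "k \<noteq> r + (k - 1)"
        using kl kr lb by auto
      have "\<not> k - 1 < l" "Suc (k - 1) = k" using kl by auto
      then show "?E i k = ?E i (r + (k - 1))" for i
        using 3 kl kr eq by (auto simp: exchange_mat_def low_cols_def high_cols_def beta_def)
    qed
  qed
  then show ?thesis by (simp add: exchange_term_def)
qed

lemma S_rev_exchange:
  fixes A :: "nat \<Rightarrow> nat \<Rightarrow> 'a :: idom"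
  assumes lam: "is_partition lam" "length lam < r" and l: "l \<in> corner_rows lam"
  shows "S_rev A r (sub_first 1 l lam) * S_rev A (r - 1) (add_first 1 l lam) =
    (\<Sum>K | admissible r lam l K. exchange_term A r lam l K)"
proof -
  note lb = corner_rows_bounds[OF l]
  have pos: "0 < part lam (Suc k)" if "k < l" for k
    using part_antimono[OF lam(1), of "Suc k" l] that lb by simp
  have "S_rev A r (sub_first 1 l lam) = fdet r (\<lambda>i k. A i (low_cols r lam l k))"
    unfolding S_rev_def
  proof (rule fdet_cong)
    fix i k assume "k < r"
    have "beta r (sub_first 1 l lam) k = low_cols r lam l k"
    proof (cases "k < l")
      case True
      \<comment> \<open>Writing \<open>r\<close> as a sum removes the truncated subtractions from
        \<open>beta\<close>; the bound comes from \<open>l \<le> length lam < r\<close>.\<close>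
      then have "Suc (Suc k) \<le> r" using lb lam(2) by linarith
      then obtain m where "r = Suc (Suc k) + m" using le_Suc_ex by blast
      then show ?thesis
        using pos[OF True] True part_sub_first[OF lam(1) lb, of "Suc k"]
        by (simp add: beta_def low_cols_def)
    qed (use part_sub_first[OF lam(1) lb, of "Suc k"] in \<open>simp add: beta_def low_cols_def\<close>)
    then show "A i (beta r (sub_first 1 l lam) k) = A i (low_cols r lam l k)" by simp
  qed
  moreover have "S_rev A (r - 1) (add_first 1 l lam) = fdet (r - 1) (\<lambda>i k. A i (high_cols r lam l k))"
    unfolding S_rev_def
  proof (rule fdet_cong)
    fix i k assume "k < r - 1"
    then have "Suc (Suc k) \<le> r" by linarith
    then obtain m where "r = Suc (Suc k) + m" using le_Suc_ex by blast
    then have "beta (r - 1) (add_first 1 l lam) k = high_cols r lam l k"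
      using part_add_first[OF lam(1) lb(2), of "Suc k"]
      by (simp add: beta_def high_cols_def)
    then show "A i (beta (r - 1) (add_first 1 l lam) k) = A i (high_cols r lam l k)" by simp
  qed
  ultimately have "S_rev A r (sub_first 1 l lam) * S_rev A (r - 1) (add_first 1 l lam) =
      (\<Sum>K\<in>Pow {..<r}. exchange_term A r lam l K)"
    using sylvester_expansion[of "r - 1" r "{..<l}" A "low_cols r lam l" "high_cols r lam l"] lb lam(2)
    by (simp add: exchange_term_def)
  also have "\<dots> = (\<Sum>K | admissible r lam l K. exchange_term A r lam l K)"
    using exchange_term_not_admissible[OF lam l]
    by (intro sum.mono_neutral_right) (auto simp: admissible_def)
  finally show ?thesis .
qed

section \<open>The first identity for an arbitrary matrix\<close>

definition strip_ends :: "nat list \<Rightarrow> nat list \<Rightarrow> nat list \<Rightarrow> (nat \<times> nat) list" where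
  "strip_ends lam ps qs = zip (map (corner_row lam) ps) (map (corner_row lam) qs)"

lemma add_pq_eq:
  assumes "is_partition lam" "p \<in> {1..card (corners lam)}" "q \<in> {1..card (corners lam)}"
  shows "add_pq lam p q = add_strip (Suc (corner_row lam p), part lam (corner_row lam p))
    (Suc (corner_row lam q), Suc (part lam (Suc (corner_row lam q))))"
  using assms by (simp add: add_pq_def[abs_def] corner_col_eq corner_col_Suc)

lemma rem_pq_eq:
  assumes "is_partition lam" "p \<in> {1..card (corners lam)}" "q \<in> {1..card (corners lam)}"
  shows "rem_pq lam p q = rem_strip (corner_row lam p, part lam (corner_row lam p))
    (corner_row lam q, Suc (part lam (Suc (corner_row lam q))))"
  using assms by (simp add: rem_pq_def[abs_def] corner_col_eq corner_col_Suc)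

lemma add_list_eq:
  assumes "is_partition lam" "set ps \<subseteq> {1..card (corners lam)}" "set qs \<subseteq> {1..card (corners lam)}"
  shows "add_list lam ps qs lam = add_strips lam (strip_ends lam ps qs)"
proof -
  have "add_pq lam p q = add_strip (Suc (corner_row lam p), part lam (corner_row lam p))
      (Suc (corner_row lam q), Suc (part lam (Suc (corner_row lam q))))"
    if "(p, q) \<in> set (zip ps qs)" for p q
    using assms set_zip_leftD[OF that] set_zip_rightD[OF that] by (intro add_pq_eq) auto
  then show ?thesis
    unfolding add_list_def add_strips_def strip_ends_def zip_map_map foldr_map
    by (intro foldr_cong) auto
qed

lemma rem_list_eq:
  assumes "is_partition lam" "set ps \<subseteq> {1..card (corners lam)}" "set qs \<subseteq> {1..card (corners lam)}"
  shows "rem_list lam ps qs lam = rem_strips lam (strip_ends lam ps qs)"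
proof -
  have "rem_pq lam p q = rem_strip (corner_row lam p, part lam (corner_row lam p))
      (corner_row lam q, Suc (part lam (Suc (corner_row lam q))))"
    if "(p, q) \<in> set (zip ps qs)" for p q
    using assms set_zip_leftD[OF that] set_zip_rightD[OF that] by (intro rem_pq_eq) auto
  then show ?thesis
    unfolding rem_list_def rem_strips_def strip_ends_def zip_map_map foldr_map
    by (intro foldr_cong) auto
qed

lemma corner_row_mono:
  assumes "1 \<le> p" "p \<le> q" "q \<le> card (corners lam)"
  shows "corner_row lam p \<le> corner_row lam q"
  using corner_row_less[of p q lam] assms by (cases "p = q") auto

lemma corner_row_le_iff:
  assumes "p \<in> {1..card (corners lam)}" "q \<in> {1..card (corners lam)}"
  shows "corner_row lam p \<le> corner_row lam q \<longleftrightarrow> p \<le> q"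
  using corner_row_less[of q p lam] corner_row_mono[of p q lam] assms by (cases "p \<le> q") auto

lemma corner_row_eq_iff:
  assumes "p \<in> {1..card (corners lam)}" "q \<in> {1..card (corners lam)}"
  shows "corner_row lam p = corner_row lam q \<longleftrightarrow> p = q"
  using corner_row_le_iff[of p lam q] corner_row_le_iff[of q lam p] assms by auto

lemma corner_row_in: "p \<in> {1..card (corners lam)} \<Longrightarrow> corner_row lam p \<in> corner_rows lam"
  using bij_betwE[OF corner_row_bij] by blast

lemma nested_pairs_strip_ends:
  assumes d: "1 \<le> d" "d \<le> card (corners lam)"
    and pq: "(ps, qs) \<in> nested_indices (card (corners lam)) d t"
  shows "nested_pairs lam (corner_row lam d) (strip_ends lam ps qs)"
proof -
  let ?n = "card (corners lam)" and ?R = "corner_row lam"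
  from pq have len: "length ps = t" "length qs = t"
    and ps: "sorted_wrt (<) ps" "set ps \<subseteq> {1..d}" and qs: "sorted_wrt (>) qs" "set qs \<subseteq> {d..?n}"
    by (auto simp: nested_indices_def)
  have "?R (ps ! i) < ?R (ps ! j) \<and> ?R (qs ! j) < ?R (qs ! i)" if "i < j" "j < t" for i j
  proof -
    have "ps ! i < ps ! j" "qs ! j < qs ! i"
      using sorted_wrt_nth_less[OF ps(1)] sorted_wrt_nth_less[OF qs(1)] that len by auto
    moreover have "ps ! i \<in> {1..d}" "ps ! j \<in> {1..d}" "qs ! i \<in> {d..?n}" "qs ! j \<in> {d..?n}"
      using that len
      by (intro subsetD[OF ps(2)] nth_mem, simp, intro subsetD[OF ps(2)] nth_mem, simp,
          intro subsetD[OF qs(2)] nth_mem, simp, intro subsetD[OF qs(2)] nth_mem, simp)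
    ultimately show ?thesis
      using corner_row_less[of "ps ! i" "ps ! j" lam] corner_row_less[of "qs ! j" "qs ! i" lam] d
      by simp
  qed
  then have "sorted_wrt (\<lambda>x y. fst x < fst y \<and> snd y < snd x) (strip_ends lam ps qs)"
    unfolding sorted_wrt_iff_nth_less strip_ends_def using len by simp
  moreover have "a \<in> corner_rows lam \<and> b \<in> corner_rows lam \<and> a \<le> ?R d \<and> ?R d \<le> b"
    if ab: "(a, b) \<in> set (strip_ends lam ps qs)" for a b
  proof -
    have "a \<in> ?R ` set ps" "b \<in> ?R ` set qs"
      using set_zip_leftD[OF ab[unfolded strip_ends_def]]
        set_zip_rightD[OF ab[unfolded strip_ends_def]] by simp_all
    then obtain p q where "p \<in> set ps" "q \<in> set qs" and pq: "a = ?R p" "b = ?R q" by blast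
    then have pq': "p \<in> {1..d}" "q \<in> {d..?n}" using ps(2) qs(2) by blast+
    moreover have "p \<in> {1..?n}" "q \<in> {1..?n}" using pq' d by auto
    then have "?R p \<in> corner_rows lam" "?R q \<in> corner_rows lam" by (auto intro: corner_row_in)
    moreover have "?R p \<le> ?R d" "?R d \<le> ?R q" using pq' d by (auto intro: corner_row_mono)
    ultimately show ?thesis using pq by blast
  qed
  ultimately show ?thesis by (auto simp: nested_pairs_def)
qed

lemma swap_set_strip_ends:
  assumes "length ps = length qs"
  shows "swap_set l (strip_ends lam ps qs) =
    ({..<l} - (\<lambda>p. corner_row lam p - 1) ` set ps) \<union> corner_row lam ` set qs"
proof -
  have "fst ` set (strip_ends lam ps qs) = corner_row lam ` set ps"
    "snd ` set (strip_ends lam ps qs) = corner_row lam ` set qs"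
    using assms by (simp_all add: strip_ends_def flip: set_map)
  moreover have "(\<lambda>x. fst x - 1) ` set (strip_ends lam ps qs) =
      (\<lambda>a. a - 1) ` fst ` set (strip_ends lam ps qs)"
    by (simp add: image_image)
  ultimately show ?thesis by (simp add: swap_set_def image_image)
qed

lemma finite_nested_indices: "finite (nested_indices n d t)"
proof (rule finite_subset)
  show "nested_indices n d t \<subseteq>
    {ps. set ps \<subseteq> {1..d} \<and> length ps = t} \<times> {qs. set qs \<subseteq> {d..n} \<and> length qs = t}"
    by (auto simp: nested_indices_def)
qed (intro finite_cartesian_product finite_lists_length_eq finite_atLeastAtMost)

text \<open>An admissible \<open>K\<close> is determined by the set \<open>P K\<close> of corners
  whose positions leave the first \<open>l\<close> and the set \<open>Q K\<close> of corners whose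
  positions enter. Strictly monotone lists encode the same sets. Since
  \<open>R d - 1 < l \<le> R d\<close>, the corner \<open>d\<close> gives one position on each side
  and belongs to both index ranges.\<close>

lemma sum_admissible:
  fixes f :: "nat set \<Rightarrow> 'a :: comm_monoid_add"
  assumes lam: "is_partition lam" "length lam < r" and d: "1 \<le> d" "d \<le> card (corners lam)"
  shows "(\<Sum>K | admissible r lam (corner_row lam d) K. f K) =
    (\<Sum>t = 0..min d (card (corners lam) - d + 1).
      \<Sum>(ps, qs) \<in> nested_indices (card (corners lam)) d t.
        f (swap_set (corner_row lam d) (strip_ends lam ps qs)))"
proof -
  define n where "n = card (corners lam)"
  define R where "R = corner_row lam"
  define l where "l = R d"
  define m where "m = min d (n - d + 1)"
  define P where "P K = {p \<in> {1..d}. R p - 1 \<notin> K}" for K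
  define Q where "Q K = {q \<in> {d..n}. R q \<in> K}" for K
  have dn: "1 \<le> d" "d \<le> n" using d by (auto simp: n_def)
  have R1: "1 \<le> R p" "R p \<in> corner_rows lam" "R p < r" if "p \<in> {1..n}" for p
    using corner_row_in[of p lam] corner_rows_bounds[of "R p" lam] that lam(2)
    by (auto simp: R_def n_def)
  have Rle: "R p \<le> R q \<longleftrightarrow> p \<le> q" and Req: "R p = R q \<longleftrightarrow> p = q"
    if "p \<in> {1..n}" "q \<in> {1..n}" for p q
    using corner_row_le_iff[of p lam q] corner_row_eq_iff[of p lam q] that by (auto simp: R_def n_def)
  have Rl: "R p - 1 < l" if "p \<in> {1..d}" for p
  proof -
    have "R p \<le> R d" "1 \<le> R p" using Rle[of p d] R1[of p] that dn by auto
    then show ?thesis unfolding l_def by linarith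
  qed
  have Rg: "l \<le> R q" if "q \<in> {d..n}" for q
    using Rle[of d q] that dn unfolding l_def by auto
  have surj: "\<exists>p\<in>{1..n}. i = R p" if "i \<in> corner_rows lam" for i
    using bij_betw_imp_surj_on[OF corner_row_bij, of lam] that unfolding R_def n_def by blast
  have inj1: "inj_on (\<lambda>p. R p - 1) {1..n}"
  proof (rule inj_onI)
    fix p q assume pq: "p \<in> {1..n}" "q \<in> {1..n}" "R p - 1 = R q - 1"
    then have "R p = R q" using R1[of p] R1[of q] by linarith
    then show "p = q" using Req pq by blast
  qed
  have injR: "inj_on R {1..n}" using Req by (auto simp: inj_on_def)
  have swap: "swap_set l (strip_ends lam ps qs) = ({..<l} - (\<lambda>p. R p - 1) ` set ps) \<union> R ` set qs"
    if "(ps, qs) \<in> nested_indices n d t" for ps qs t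
    using that unfolding R_def by (intro swap_set_strip_ends) (auto simp: nested_indices_def)
  have PQ: "P (swap_set l (strip_ends lam ps qs)) = set ps" "Q (swap_set l (strip_ends lam ps qs)) = set qs"
    if pq: "(ps, qs) \<in> nested_indices n d t" for ps qs t
  proof -
    from pq have sub: "set ps \<subseteq> {1..d}" "set qs \<subseteq> {d..n}" by (auto simp: nested_indices_def)
    have "R p - 1 \<in> swap_set l (strip_ends lam ps qs) \<longleftrightarrow> p \<notin> set ps" if p: "p \<in> {1..d}" for p
    proof -
      have "R p - 1 \<notin> R ` set qs" using Rl[OF p] Rg sub(2) by fastforce
      moreover have "R p - 1 \<in> (\<lambda>p. R p - 1) ` set ps \<longleftrightarrow> p \<in> set ps"
        using p sub(1) dn by (intro inj_on_image_mem_iff[OF inj1]) auto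
      ultimately show ?thesis using Rl[OF p] unfolding swap[OF pq] by blast
    qed
    then show "P (swap_set l (strip_ends lam ps qs)) = set ps" using sub by (auto simp: P_def)
    have "R q \<in> swap_set l (strip_ends lam ps qs) \<longleftrightarrow> q \<in> set qs" if q: "q \<in> {d..n}" for q
    proof -
      have "R q \<in> R ` set qs \<longleftrightarrow> q \<in> set qs"
        using q sub(2) dn by (intro inj_on_image_mem_iff[OF injR]) auto
      moreover have "R q \<notin> {..<l}" using Rg[OF q] by simp
      ultimately show ?thesis unfolding swap[OF pq] by blast
    qed
    then show "Q (swap_set l (strip_ends lam ps qs)) = set qs" using sub by (auto simp: Q_def)
  qed
  have fin: "finite (P K)" "finite (Q K)" for K by (auto simp: P_def Q_def)
  have adm1: "K = ({..<l} - (\<lambda>p. R p - 1) ` P K) \<union> R ` Q K" (is ?eq) and adm2: "card (P K) = card (Q K)"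
    if K: "admissible r lam l K" for K
  proof -
    have low: "k \<in> (\<lambda>p. R p - 1) ` P K" if "k < l" "k \<notin> K" for k
    proof -
      from K that have "Suc k \<in> corner_rows lam" by (auto simp: admissible_def)
      then obtain p where p: "p \<in> {1..n}" "Suc k = R p" using surj by blast
      then have "R p \<le> R d" using that by (simp add: l_def)
      then have "p \<le> d" using Rle[of p d] p dn by auto
      moreover have "k = R p - 1" using p by linarith
      ultimately show ?thesis using p that by (auto simp: P_def)
    qed
    have high: "k \<in> R ` Q K" if "l \<le> k" "k \<in> K" for k
    proof -
      from K that have "k \<in> corner_rows lam" by (auto simp: admissible_def)
      then obtain q where q: "q \<in> {1..n}" "k = R q" using surj by blast
      then have "d \<le> q" using Rle[of d q] that dn by (auto simp: l_def)
      then show ?thesis using q that by (auto simp: Q_def)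
    qed
    have "x \<in> K \<longleftrightarrow> x \<in> ({..<l} - (\<lambda>p. R p - 1) ` P K) \<union> R ` Q K" for x
    proof (cases "x < l")
      case True
      then have "x \<notin> R ` Q K" using Rg by (fastforce simp: Q_def)
      moreover have "x \<in> (\<lambda>p. R p - 1) ` P K \<Longrightarrow> x \<notin> K" by (auto simp: P_def)
      ultimately show ?thesis using low[OF True] True by blast
    next
      case False
      then show ?thesis using high[of x] by (auto simp: Q_def)
    qed
    then show ?eq by blast
    have sub1: "(\<lambda>p. R p - 1) ` P K \<subseteq> {..<l}" using Rl by (auto simp: P_def)
    have c1: "card ((\<lambda>p. R p - 1) ` P K) = card (P K)"
      using dn by (intro card_image inj_on_subset[OF inj1]) (auto simp: P_def)
    have c2: "card (R ` Q K) = card (Q K)"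
      using dn by (intro card_image inj_on_subset[OF injR]) (auto simp: Q_def)
    \<comment> \<open>Counting gives \<open>l = (l - card (P K)) + card (Q K)\<close>: as many
      positions enter as leave.\<close>
    have "l = card K" using K by (simp add: admissible_def)
    also have "\<dots> = card ({..<l} - (\<lambda>p. R p - 1) ` P K) + card (R ` Q K)"
    proof (subst \<open>?eq\<close>, rule card_Un_disjoint)
      show "({..<l} - (\<lambda>p. R p - 1) ` P K) \<inter> R ` Q K = {}" using Rg by (fastforce simp: Q_def)
    qed (simp_all add: fin)
    also have "card ({..<l} - (\<lambda>p. R p - 1) ` P K) = l - card (P K)"
      using sub1 c1 fin by (simp add: card_Diff_subset)
    finally show "card (P K) = card (Q K)"
      using card_mono[OF _ sub1] c1 c2 by simp
  qed
  have mem: "(sorted_list_of_set (P K), rev (sorted_list_of_set (Q K))) \<in> nested_indices n d (card (P K))"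
    "card (P K) \<le> m" if "admissible r lam l K" for K
  proof -
    show "(sorted_list_of_set (P K), rev (sorted_list_of_set (Q K))) \<in> nested_indices n d (card (P K))"
      using adm2[OF that] fin
      by (auto simp: nested_indices_def sorted_wrt_rev P_def Q_def)
    \<comment> \<open>The sizes of the two index ranges are the origin of the upper limit
      \<open>min d (n - d + 1)\<close> of the sum.\<close>
    have "card (P K) \<le> card {1..d}" by (rule card_mono) (auto simp: P_def)
    moreover have "card (Q K) \<le> card {d..n}" by (rule card_mono) (auto simp: Q_def)
    ultimately show "card (P K) \<le> m" using adm2[OF that] dn by (simp add: m_def Suc_diff_le)
  qed
  define i where "i = (\<lambda>(t :: nat, ps, qs). swap_set l (strip_ends lam ps qs))"
  define j where "j K = (card (P K), sorted_list_of_set (P K), rev (sorted_list_of_set (Q K)))" for K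
  have "(\<Sum>K | admissible r lam l K. f K) = (\<Sum>y \<in> Sigma {0..m} (nested_indices n d). f (i y))"
  proof (rule sum.reindex_bij_witness[where i = i and j = j])
    fix K assume "K \<in> {K. admissible r lam l K}"
    then have K: "admissible r lam l K" by simp
    show eq: "i (j K) = K"
      using swap[OF mem(1)[OF K]] adm1[OF K] fin by (simp add: i_def j_def)
    show "j K \<in> Sigma {0..m} (nested_indices n d)"
      using mem[OF K] by (simp add: j_def)
    show "f (i (j K)) = f K"
      using eq by simp
  next
    fix y assume "y \<in> Sigma {0..m} (nested_indices n d)"
    then obtain t ps qs where y: "y = (t, ps, qs)" "t \<le> m" "(ps, qs) \<in> nested_indices n d t" by auto
    let ?K = "swap_set l (strip_ends lam ps qs)"
    from y(3) have props: "length ps = t" "length qs = t" "sorted_wrt (<) ps" "sorted_wrt (>) qs"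
      "set ps \<subseteq> {1..d}" "set qs \<subseteq> {d..n}"
      by (auto simp: nested_indices_def)
    have "sorted_list_of_set (set ps) = ps"
      using props(3) by (simp add: strict_sorted_iff sorted_list_of_set.idem_if_sorted_distinct)
    moreover have "sorted_wrt (<) (rev qs)" using props(4) by (simp add: sorted_wrt_rev)
    then have "sorted_list_of_set (set (rev qs)) = rev qs"
      unfolding strict_sorted_iff by (intro sorted_list_of_set.idem_if_sorted_distinct) auto
    moreover have "card (set ps) = t"
      using props(1,3) by (metis distinct_card strict_sorted_iff)
    ultimately show "j (i y) = y"
      using PQ[OF y(3)] y(1) by (simp add: i_def j_def)
    have nested: "nested_pairs lam l (strip_ends lam ps qs)"
      unfolding l_def R_def by (rule nested_pairs_strip_ends[OF d y(3)[unfolded n_def]])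
    obtain \<sigma> where "bij_betw \<sigma> {..<l} ?K"
      using exists_exchange_bij[OF nested] by blast
    then have "card ?K = l" by (metis bij_betw_same_card card_lessThan)
    moreover have "?K \<subseteq> {..<r}"
      using R1(2)[of d] dn
      by (intro swap_set_subset[OF nested lam(2)]) (auto simp: l_def dest: corner_rows_bounds)
    moreover have "Suc k \<in> corner_rows lam" if "k < l" "k \<notin> ?K" for k
    proof -
      from that obtain p where p: "p \<in> set ps" "k = R p - 1" unfolding swap[OF y(3)] by auto
      then have "p \<in> {1..n}" using props(5) dn by auto
      then show ?thesis using R1[of p] p(2) by simp
    qed
    moreover have "k \<in> corner_rows lam" if "l \<le> k" "k \<in> ?K" for k
      using that R1 props(6) dn unfolding swap[OF y(3)] by auto
    ultimately show "i y \<in> {K. admissible r lam l K}"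
      by (simp add: admissible_def i_def y(1))
  qed
  also have "\<dots> = (\<Sum>t = 0..m. \<Sum>(ps, qs) \<in> nested_indices n d t.
      f (swap_set l (strip_ends lam ps qs)))"
    by (subst sum.Sigma) (auto simp: finite_nested_indices i_def intro!: sum.cong)
  finally show ?thesis by (simp add: l_def R_def n_def m_def)
qed

lemma nested_indices_0: "nested_indices n d 0 = {([], [])}"
  by (auto simp: nested_indices_def)

theorem S_gen_identity:
  fixes A :: "nat \<Rightarrow> nat \<Rightarrow> 'a :: idom"
  assumes lam: "is_partition lam" "length lam < r"
    and n: "n = card (corners lam)" and d: "1 \<le> d" "d \<le> n"
  shows "S_gen A r lam * S_gen A (r - 1) lam =
    S_gen A r (sub_first 1 (corner_row lam d) lam) *
    S_gen A (r - 1) (add_first 1 (corner_row lam d) lam) +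
    (\<Sum>t = 1..min d (n - d + 1). (-1) ^ (t - 1) * (\<Sum>(ps, qs) \<in> nested_indices n d t.
       S_gen A r (add_list lam ps qs lam) * S_gen A (r - 1) (rem_list lam ps qs lam)))"
proof -
  let ?l = "corner_row lam d"
  have l: "?l \<in> corner_rows lam" using d n by (intro corner_row_in) auto
  define g where "g ps qs = S_rev A r (add_list lam ps qs lam) * S_rev A (r - 1) (rem_list lam ps qs lam)"
    for ps qs
  define G where "G t = (\<Sum>(ps, qs) \<in> nested_indices n d t. g ps qs)" for t
  have "exchange_term A r lam ?l (swap_set ?l (strip_ends lam ps qs)) = (-1) ^ t * g ps qs"
    if pq: "(ps, qs) \<in> nested_indices n d t" for ps qs t
  proof -
    have "set ps \<subseteq> {1..n}" "set qs \<subseteq> {1..n}" "length ps = t" "length qs = t"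
      using pq d by (auto simp: nested_indices_def)
    moreover have "nested_pairs lam ?l (strip_ends lam ps qs)"
      using nested_pairs_strip_ends d pq n by blast
    ultimately show ?thesis
      using exchange_term_swap_set[OF lam corner_rows_bounds(2)[OF l], of "strip_ends lam ps qs" A] n
      by (simp add: g_def add_list_eq[OF lam(1)] rem_list_eq[OF lam(1)]) (simp add: strip_ends_def)
  qed
  then have inner: "(\<Sum>(ps, qs) \<in> nested_indices n d t.
      exchange_term A r lam ?l (swap_set ?l (strip_ends lam ps qs))) = (-1) ^ t * G t" for t
    unfolding G_def sum_distrib_left by (intro sum.cong) auto
  have "S_rev A r (sub_first 1 ?l lam) * S_rev A (r - 1) (add_first 1 ?l lam) =
      (\<Sum>t = 0..min d (n - d + 1). (-1) ^ t * G t)"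
    unfolding S_rev_exchange[OF lam l] sum_admissible[OF lam d(1) d(2)[unfolded n]] n[symmetric] inner ..
  \<comment> \<open>The term \<open>t = 0\<close> carries no strips and is the product that the
    theorem solves for; the other terms change sides and thus sign.\<close>
  also have "\<dots> = G 0 + (\<Sum>t = 1..min d (n - d + 1). (-1) ^ t * G t)"
    by (simp add: sum.atLeast_Suc_atMost)
  also have "(\<Sum>t = 1..min d (n - d + 1). (-1) ^ t * G t) =
      - (\<Sum>t = 1..min d (n - d + 1). (-1) ^ (t - 1) * G t)"
  proof -
    have "(-1) ^ t * G t = - ((-1) ^ (t - 1) * G t)" if "t \<in> {1..min d (n - d + 1)}" for t
      using that by (cases t) auto
    then show ?thesis by (simp add: sum_negf[symmetric])
  qed
  also have "G 0 = S_rev A r lam * S_rev A (r - 1) lam"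
    by (simp add: G_def nested_indices_0 g_def add_list_def rem_list_def)
  finally have rev: "S_rev A r lam * S_rev A (r - 1) lam =
      S_rev A r (sub_first 1 ?l lam) * S_rev A (r - 1) (add_first 1 ?l lam) +
      (\<Sum>t = 1..min d (n - d + 1). (-1) ^ (t - 1) * G t)"
    by (simp add: algebra_simps)
  \<comment> \<open>The signs of the two column reversals, common to all products of a minor of size
    \<open>r\<close> and one of size \<open>r - 1\<close>.\<close>
  define e :: 'a where "e = signof (\<lambda>b. if b < r then r - 1 - b else b) *
    signof (\<lambda>b. if b < r - 1 then r - 1 - 1 - b else b)"
  have gen: "S_gen A r mu * S_gen A (r - 1) nu = e * (S_rev A r mu * S_rev A (r - 1) nu)" for mu nu
    unfolding S_gen_eq e_def by (simp only: mult_ac)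
  show ?thesis
    unfolding gen rev by (simp add: G_def g_def distrib_left sum_distrib_left case_prod_unfold mult.left_commute)
qed

section \<open>The Gauss decomposition of the generic matrix\<close>

lemma obtain_inverse_mat:
  fixes A :: "'a :: field mat"
  assumes "A \<in> carrier_mat n n" "det A \<noteq> 0"
  obtains B where "B \<in> carrier_mat n n" "A * B = 1\<^sub>m n" "B * A = 1\<^sub>m n"
  using det_non_zero_imp_unit[OF assms, of undefined] by (auto simp: Units_def ring_mat_def)

lemma gauss_decomposition_entry:
  assumes "gauss_decomposition N A L D U" "i < N" "j < N"
  shows "A $$ (i, j) = (\<Sum>m<N. L $$ (i, m) * D $$ (m, m) * U $$ (m, j))"
proof -
  from assms have c: "L \<in> carrier_mat N N" "D \<in> carrier_mat N N" "U \<in> carrier_mat N N"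
    and D: "diagonal_mat D" and A: "A = L * D * U"
    by (auto simp: gauss_decomposition_def)
  have LD: "(L * D) $$ (i, m) = L $$ (i, m) * D $$ (m, m)" if "m < N" for m
  proof -
    have "(L * D) $$ (i, m) = (\<Sum>k = 0..<N. L $$ (i, k) * D $$ (k, m))"
      using c assms that by (simp add: scalar_prod_def)
    also have "\<dots> = (\<Sum>k = 0..<N. if k = m then L $$ (i, m) * D $$ (m, m) else 0)"
      using D c that by (intro sum.cong) (auto simp: diagonal_mat_def)
    finally show ?thesis using that by simp
  qed
  define M where "M = L * D"
  have "M \<in> carrier_mat N N" using c by (simp add: M_def)
  then have "(M * U) $$ (i, j) = (\<Sum>m = 0..<N. M $$ (i, m) * U $$ (m, j))"
    using c assms by (simp add: scalar_prod_def)
  then have "A $$ (i, j) = (\<Sum>m = 0..<N. (L * D) $$ (i, m) * U $$ (m, j))"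
    unfolding A M_def .
  also have "\<dots> = (\<Sum>m<N. L $$ (i, m) * D $$ (m, m) * U $$ (m, j))"
    by (intro sum.cong) (auto simp: LD)
  finally show ?thesis .
qed

lemma det_upper_unitriangular:
  assumes "U \<in> carrier_mat N N" "upper_unitriangular U"
  shows "det U = 1"
proof -
  have "det U = prod_list (diag_mat U)"
    using assms by (intro det_upper_triangular) (auto simp: upper_unitriangular_def)
  also have "diag_mat U = map (\<lambda>i. 1) [0..<N]"
    using assms unfolding diag_mat_def upper_unitriangular_def by auto
  finally show ?thesis by (simp add: map_replicate_const prod_list_replicate)
qed

lemma gauss_decomposition_det:
  assumes "gauss_decomposition N A L D U"
  shows "det A = (\<Prod>m<N. D $$ (m, m))"
proof -
  from assms have c: "L \<in> carrier_mat N N" "D \<in> carrier_mat N N" "U \<in> carrier_mat N N"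
    and LU: "upper_unitriangular (transpose_mat L)" "upper_unitriangular U"
    and D: "diagonal_mat D" and A: "A = L * D * U"
    by (auto simp: gauss_decomposition_def)
  have "det L = 1"
    using det_upper_unitriangular[OF _ LU(1), of N] c det_transpose[of L N] by simp
  moreover have "det D = prod_list (diag_mat D)"
    using c D by (intro det_upper_triangular) (auto simp: diagonal_mat_def)
  moreover have "prod_list (diag_mat D) = (\<Prod>m<N. D $$ (m, m))"
    using c by (simp add: prod_list_diag_prod lessThan_atLeast0)
  ultimately show ?thesis
    unfolding A using c det_upper_unitriangular[OF c(3) LU(2)]
    by (simp add: det_mult[of _ N])
qed

text \<open>For \<open>i = k\<close> or \<open>j = k\<close>, triangularity ends the sum for the
  entry \<open>(i, j)\<close> at \<open>m = k\<close>, and its earlier terms agree by induction.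
  Comparing the terms for \<open>m = k\<close> determines the diagonal entry, then column
  \<open>k\<close> of \<open>L\<close> and row \<open>k\<close> of \<open>U\<close>. The diagonal
  entry can be cancelled because the product of all of them is \<open>det A\<close>.\<close>

lemma gauss_decomposition_unique:
  fixes A :: "'a :: field mat"
  assumes g: "gauss_decomposition N A L D U" and g': "gauss_decomposition N A L' D' U'"
    and det: "det A \<noteq> 0"
  shows "U = U'"
proof -
  from g have c: "L \<in> carrier_mat N N" "D \<in> carrier_mat N N" "U \<in> carrier_mat N N"
    and L0: "\<And>i j. i < j \<Longrightarrow> j < N \<Longrightarrow> L $$ (i, j) = 0" and L1: "\<And>i. i < N \<Longrightarrow> L $$ (i, i) = 1"
    and U0: "\<And>i j. j < i \<Longrightarrow> i < N \<Longrightarrow> U $$ (i, j) = 0" and U1: "\<And>i. i < N \<Longrightarrow> U $$ (i, i) = 1"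
    by (auto simp: gauss_decomposition_def upper_unitriangular_def upper_triangular_def)
  from g' have c': "L' \<in> carrier_mat N N" "D' \<in> carrier_mat N N" "U' \<in> carrier_mat N N"
    and L0': "\<And>i j. i < j \<Longrightarrow> j < N \<Longrightarrow> L' $$ (i, j) = 0" and L1': "\<And>i. i < N \<Longrightarrow> L' $$ (i, i) = 1"
    and U0': "\<And>i j. j < i \<Longrightarrow> i < N \<Longrightarrow> U' $$ (i, j) = 0" and U1': "\<And>i. i < N \<Longrightarrow> U' $$ (i, i) = 1"
    by (auto simp: gauss_decomposition_def upper_unitriangular_def upper_triangular_def)
  have Dnz: "D $$ (k, k) \<noteq> 0" if "k < N" for k
    using det that unfolding gauss_decomposition_det[OF g] by auto
  have split: "(\<Sum>m<N. h m) = (\<Sum>m<k. h m) + h k" if "k < N" "\<And>m. k < m \<Longrightarrow> m < N \<Longrightarrow> h m = 0"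
    for k and h :: "nat \<Rightarrow> 'a"
  proof -
    have "(\<Sum>m<N. h m) = (\<Sum>m<Suc k. h m)"
      using that by (intro sum.mono_neutral_right) auto
    then show ?thesis by simp
  qed
  have "D $$ (k, k) = D' $$ (k, k) \<and> (\<forall>i<N. L $$ (i, k) = L' $$ (i, k)) \<and>
      (\<forall>j<N. U $$ (k, j) = U' $$ (k, j))" if "k < N" for k
    using that
  proof (induction k rule: less_induct)
    case (less k)
    note IH = less.IH[OF _ less_trans[OF _ less.prems]]
    let ?a = "\<lambda>i m j. L $$ (i, m) * D $$ (m, m) * U $$ (m, j)"
    let ?b = "\<lambda>i m j. L' $$ (i, m) * D' $$ (m, m) * U' $$ (m, j)"
    have eq: "?a i k j = ?b i k j" if ij: "i < N" "j < N" "i = k \<or> j = k" for i j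
    proof -
      have "(\<Sum>m<k. ?a i m j) + ?a i k j = A $$ (i, j)"
        unfolding gauss_decomposition_entry[OF g ij(1,2)]
        using ij less.prems L0 U0 by (intro split[symmetric]) auto
      also have "\<dots> = (\<Sum>m<k. ?b i m j) + ?b i k j"
        unfolding gauss_decomposition_entry[OF g' ij(1,2)]
        using ij less.prems L0' U0' by (intro split) auto
      also have "(\<Sum>m<k. ?b i m j) = (\<Sum>m<k. ?a i m j)"
        using IH ij by (intro sum.cong) auto
      finally show ?thesis by simp
    qed
    have Dk: "D $$ (k, k) = D' $$ (k, k)"
      using eq[of k k] less.prems by (simp add: L1 L1' U1 U1')
    moreover have "L $$ (i, k) = L' $$ (i, k)" if "i < N" for i
      using eq[of i k] that less.prems Dnz[of k] Dk by (simp add: U1 U1')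
    moreover have "U $$ (k, j) = U' $$ (k, j)" if "j < N" for j
      using eq[of k j] that less.prems Dnz[of k] Dk by (simp add: L1 L1')
    ultimately show ?case by blast
  qed
  then show ?thesis using c c' by (intro eq_matI) auto
qed

text \<open>Induction by bordering. The new column \<open>x\<close> of \<open>U\<close> and the new
  row \<open>y\<close> of \<open>L\<close> solve \<open>L * D * x = ?B\<close> and
  \<open>y * (D * U) = ?C\<close>, and the new diagonal entry \<open>s\<close> is the Schur
  complement. The leading minor of size \<open>N\<close> makes both systems solvable.\<close>

lemma gauss_decomposition_exists:
  fixes A :: "'a :: field mat"
  assumes "A \<in> carrier_mat N N"
    and "\<And>k. k \<le> N \<Longrightarrow> det (mat k k (\<lambda>(i, j). A $$ (i, j))) \<noteq> 0"
  shows "\<exists>L D U. gauss_decomposition N A L D U"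
  using assms
proof (induction N arbitrary: A)
  case 0
  then show ?case
    by (intro exI[of _ A]) (auto simp: gauss_decomposition_def upper_unitriangular_def
        diagonal_mat_def intro!: eq_matI)
next
  case (Suc N)
  let ?A0 = "mat N N (\<lambda>(i, j). A $$ (i, j))"
  let ?B = "mat N 1 (\<lambda>(i, j). A $$ (i, N))" and ?C = "mat 1 N (\<lambda>(i, j). A $$ (N, j))"
  let ?a = "mat 1 1 (\<lambda>(i, j). A $$ (N, N))"
  have A: "A = four_block_mat ?A0 ?B ?C ?a"
    using Suc.prems(1) by (auto intro!: eq_matI simp: less_Suc_eq)
  have "det (mat k k (\<lambda>(i, j). ?A0 $$ (i, j))) \<noteq> 0" if "k \<le> N" for k
  proof -
    have "mat k k (\<lambda>(i, j). ?A0 $$ (i, j)) = mat k k (\<lambda>(i, j). A $$ (i, j))"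
      using that by (auto intro!: eq_matI)
    then show ?thesis using Suc.prems(2)[of k] that by simp
  qed
  then obtain L D U where g: "gauss_decomposition N ?A0 L D U"
    using Suc.IH[of ?A0] by auto
  then have c: "L \<in> carrier_mat N N" "D \<in> carrier_mat N N" "U \<in> carrier_mat N N"
    and tri: "upper_unitriangular (transpose_mat L)" "upper_unitriangular U" "diagonal_mat D"
    and A0: "?A0 = L * D * U"
    by (auto simp: gauss_decomposition_def)
  have "det ?A0 \<noteq> 0" using Suc.prems(2)[of N] by simp
  then have "det (L * D) \<noteq> 0" "det (D * U) \<noteq> 0"
    unfolding A0 using c by (auto simp: det_mult[of _ N])
  moreover have "L * D \<in> carrier_mat N N" "D * U \<in> carrier_mat N N" using c by auto
  ultimately obtain P Q where P: "P \<in> carrier_mat N N" "(L * D) * P = 1\<^sub>m N"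
    and Q: "Q \<in> carrier_mat N N" "Q * (D * U) = 1\<^sub>m N"
    by (elim obtain_inverse_mat[of "L * D" N] obtain_inverse_mat[of "D * U" N])
  define x where "x = P * ?B"
  define y where "y = ?C * Q"
  have xy: "x \<in> carrier_mat N 1" "y \<in> carrier_mat 1 N" using P Q by (auto simp: x_def y_def)
  have x: "L * D * x = ?B"
    using P c by (simp add: x_def assoc_mult_mat[symmetric, of _ N N _ N _ 1])
  have y: "y * (D * U) = ?C"
    using Q c by (simp add: y_def assoc_mult_mat[of _ 1 N _ N _ N])
  define s where "s = ?a - y * D * x"
  have s: "s \<in> carrier_mat 1 1" using xy c by (auto simp: s_def)
  let ?L = "four_block_mat L (0\<^sub>m N 1) y (1\<^sub>m 1)"
  let ?D = "four_block_mat D (0\<^sub>m N 1) (0\<^sub>m 1 N) s"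
  let ?U = "four_block_mat U x (0\<^sub>m 1 N) (1\<^sub>m 1)"
  have LD: "?L * ?D = four_block_mat (L * D) (0\<^sub>m N 1) (y * D) s"
    using c xy s by (subst mult_four_block_mat[of _ N N _ 1 _ 1]) auto
  have "?L * ?D * ?U = four_block_mat (L * D * U) (L * D * x) (y * D * U) (y * D * x + s)"
    unfolding LD using c xy s
    by (subst mult_four_block_mat[of _ N N _ 1 _ 1]) auto
  also have "y * D * U = y * (D * U)" using c xy by (intro assoc_mult_mat) auto
  also have "y * D * x + s = ?a"
    using c xy by (auto intro!: eq_matI simp: s_def)
  finally have "A = ?L * ?D * ?U" using A x y A0 by simp
  moreover have "?L \<in> carrier_mat (Suc N) (Suc N)" "?D \<in> carrier_mat (Suc N) (Suc N)"
    "?U \<in> carrier_mat (Suc N) (Suc N)"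
    using c xy s by auto
  moreover have "upper_unitriangular (transpose_mat ?L)"
    using tri(1) c xy
    by (auto simp: upper_unitriangular_def upper_triangular_def less_Suc_eq)
  moreover have "upper_unitriangular ?U"
    using tri(2) c xy
    by (auto simp: upper_unitriangular_def upper_triangular_def less_Suc_eq)
  moreover have "diagonal_mat ?D"
    using tri(3) c s by (auto simp: diagonal_mat_def less_Suc_eq)
  ultimately show ?case
    unfolding gauss_decomposition_def by blast
qed

section \<open>The leading minors of the generic matrix do not vanish\<close>

lemma prod_single:
  "(\<Prod>i\<in>S. Poly_Mapping.single (m i) (1 :: 'b :: comm_semiring_1)) =
    Poly_Mapping.single (\<Sum>i\<in>S. m i :: 'a :: comm_monoid_add) 1"
  by (induction S rule: infinite_finite_induct) (simp_all add: mult_single)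

interpretation fract_hom: comm_ring_hom "\<lambda>p :: 'a :: idom. Fract p 1"
  by unfold_locales (simp_all add: Zero_fract_def One_fract_def)

text \<open>The monomial of the diagonal occurs only for the identity permutation.\<close>

lemma det_generic_poly:
  "fdet k (\<lambda>i j. Poly_Mapping.single (Poly_Mapping.single (i + 1, j + 1) 1) 1 :: cpoly) \<noteq> 0"
proof -
  \<comment> \<open>\<open>e p\<close> is the exponent of the monomial of \<open>p\<close> in the
    Leibniz formula; its values at the diagonal variables detect the fixed points of
    \<open>p\<close>.\<close>
  define e :: "(nat \<Rightarrow> nat) \<Rightarrow> (nat \<times> nat) \<Rightarrow>\<^sub>0 nat"
    where "e p = (\<Sum>i = 0..<k. Poly_Mapping.single (i + 1, p i + 1) 1)" for p
  have lookup_e: "Poly_Mapping.lookup (e p) (j + 1, j + 1) = (if p j = j then 1 else 0)"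
    if "j < k" for p j
  proof -
    have "Poly_Mapping.lookup (e p) (j + 1, j + 1) =
        (\<Sum>i = 0..<k. if i = j then if p j = j then 1 else 0 else 0)"
      unfolding e_def lookup_sum by (intro sum.cong) (auto simp: lookup_single when_def)
    then show ?thesis using that by simp
  qed
  have e_id: "e p = e id \<longleftrightarrow> p = id" if p: "p permutes {0..<k}" for p
  proof
    assume eq: "e p = e id"
    have "p j = j" for j
    proof (cases "j < k")
      case True
      then have "Poly_Mapping.lookup (e p) (j + 1, j + 1) = 1"
        unfolding eq using lookup_e[OF True, of id] by simp
      then show ?thesis using lookup_e[OF True, of p] by (simp split: if_splits)
    qed (use permutes_not_in[OF p] in auto)
    then show "p = id" by auto
  qed simp
  let ?t = "\<lambda>p. signof p * Poly_Mapping.single (e p) 1 :: cpoly"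
  have lookup_t: "Poly_Mapping.lookup (?t p) (e id) = (if p = id then 1 else 0)"
    if "p permutes {0..<k}" for p
  proof (cases "sign p = 1")
    case True
    then show ?thesis using e_id[OF that] by (simp add: lookup_single when_def)
  next
    case False
    then have s: "sign p = -1" by (cases p rule: sign_cases) auto
    then have "p \<noteq> id" by auto
    then show ?thesis using s e_id[OF that] by (simp add: lookup_single when_def)
  qed
  have "fdet k (\<lambda>i j. Poly_Mapping.single (Poly_Mapping.single (i + 1, j + 1) 1) 1 :: cpoly) =
      (\<Sum>p | p permutes {0..<k}. ?t p)"
    unfolding fdet_eq_sum_rows e_def by (simp only: prod_single)
  also have "Poly_Mapping.lookup \<dots> (e id) =
      (\<Sum>p | p permutes {0..<k}. if p = id then 1 else 0)"
    unfolding lookup_sum by (intro sum.cong) (simp_all add: lookup_t)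
  also have "\<dots> = 1"
    using permutes_id[of "{0..<k}"] finite_permutations[of "{0..<k}"]
    by (subst sum.delta) auto
  finally show ?thesis by (metis lookup_zero zero_neq_one)
qed

lemma det_generic_mat_leading:
  assumes "k \<le> N"
  shows "det (mat k k (\<lambda>(i, j). generic_mat N $$ (i, j))) \<noteq> 0"
proof -
  let ?M = "mat k k (\<lambda>(i, j). Poly_Mapping.single (Poly_Mapping.single (i + 1, j + 1) 1) 1 :: cpoly)"
  have "mat k k (\<lambda>(i, j). generic_mat N $$ (i, j)) = map_mat (\<lambda>p. Fract p 1) ?M"
    using assms by (intro eq_matI) (simp_all add: generic_mat_def indet_def)
  moreover have "det ?M \<noteq> 0" using det_generic_poly[of k] by (simp add: fdet_def)
  moreover have "Fract (det ?M) 1 = 0 \<longleftrightarrow> det ?M = 0"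
    unfolding Zero_fract_def by (subst eq_fract(1)) simp_all
  ultimately show ?thesis
    by (simp only: fract_hom.hom_det) simp
qed

text \<open>Existence comes from all leading minors and uniqueness from the full determinant;
  together they justify the definite description in \<open>X_plus\<close>.\<close>

lemma X_plus_decomposition: "\<exists>L D. gauss_decomposition N (generic_mat N) L D (X_plus N)"
proof -
  have c: "generic_mat N \<in> carrier_mat N N" by (simp add: generic_mat_def)
  have "mat N N (\<lambda>(i, j). generic_mat N $$ (i, j)) = generic_mat N"
    by (intro eq_matI) (simp_all add: generic_mat_def)
  then have det: "det (generic_mat N) \<noteq> 0"
    using det_generic_mat_leading[of N N] by simp
  obtain L D U where g: "gauss_decomposition N (generic_mat N) L D U"
    using gauss_decomposition_exists[OF c det_generic_mat_leading] by blast
  have "\<exists>!U. \<exists>L D. gauss_decomposition N (generic_mat N) L D U"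
  proof (rule ex1I[of _ U])
    show "\<exists>L D. gauss_decomposition N (generic_mat N) L D U" using g by blast
    fix U' assume "\<exists>L D. gauss_decomposition N (generic_mat N) L D U'"
    then show "U' = U" using gauss_decomposition_unique[OF _ g det] by blast
  qed
  then show ?thesis unfolding X_plus_def by (rule theI')
qed

lemma X_plus_unitriangular: "X_plus N \<in> carrier_mat N N" "upper_unitriangular (X_plus N)"
  using X_plus_decomposition[of N] by (auto simp: gauss_decomposition_def)

section \<open>Complementary minors and conjugate partitions\<close>

text \<open>Lists the columns \<open>lam\<^sub>r\<^sub>-\<^sub>b + b\<close> of the minor and then, increasingly, the complementary columns,
  which are given by the conjugate parts \<open>g\<close>.\<close>

definition grassmann_perm :: "nat \<Rightarrow> nat \<Rightarrow> (nat \<Rightarrow> nat) \<Rightarrow> (nat \<Rightarrow> nat) \<Rightarrow> nat \<Rightarrow> nat" where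
  "grassmann_perm N r f g b =
    (if b < r then f (r - b) + b else if b < N then b - g (Suc (b - r)) else b)"

text \<open>Removing one cell of the diagram composes the permutation with an adjacent transposition.\<close>

lemma grassmann_perm_sign:
  assumes "r \<le> N" and "\<And>i j. 1 \<le> i \<Longrightarrow> 1 \<le> j \<Longrightarrow> j \<le> f i \<longleftrightarrow> i \<le> g j"
    and "\<And>i. r < i \<Longrightarrow> f i = 0" and "\<And>j. N - r < j \<Longrightarrow> g j = 0"
  shows "grassmann_perm N r f g permutes {0..<N} \<and>
    signof (grassmann_perm N r f g) = ((-1) ^ (\<Sum>j = 1..N - r. g j) :: int)"
  using assms(2-)
proof (induction "\<Sum>j = 1..N - r. g j" arbitrary: f g)
  case 0
  then have g: "g j = 0" if "1 \<le> j" for j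
    using that by (cases "j \<le> N - r") auto
  have f: "f i = 0" if "1 \<le> i" for i
    using 0(2)[of i 1] g[of 1] that by simp
  have "grassmann_perm N r f g = id"
    by (rule ext) (auto simp: grassmann_perm_def f g)
  then show ?case by (simp add: permutes_id[unfolded id_def] g)
next
  case (Suc n)
  \<comment> \<open>\<open>(i, j)\<close> will be the bottom cell of the last nonempty column. It is
    a corner, so removing it preserves the correspondence between \<open>f\<close> and
    \<open>g\<close>.\<close>
  define J where "J = {j \<in> {1..N - r}. 0 < g j}"
  define j where "j = Max J"
  define i where "i = g j"
  have "J \<noteq> {}"
  proof
    assume "J = {}"
    then have "(\<Sum>j = 1..N - r. g j) = 0" by (auto simp: J_def)
    with Suc.hyps(2) show False by simp
  qed
  then have "j \<in> J" unfolding j_def by (intro Max_in) (auto simp: J_def)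
  then have j: "1 \<le> j" "j \<le> N - r" and i: "1 \<le> i" by (auto simp: J_def i_def)
  have "g (Suc j) = 0"
  proof (rule ccontr)
    assume "g (Suc j) \<noteq> 0"
    then have "Suc j \<in> J" using Suc.prems(3)[of "Suc j"] by (cases "N - r < Suc j") (auto simp: J_def)
    then have "Suc j \<le> j" unfolding j_def by (intro Max_ge) (auto simp: J_def)
    then show False by simp
  qed
  then have fi: "f i = j"
    using Suc.prems(1)[of i j] Suc.prems(1)[of i "Suc j"] i j by (simp add: i_def)
  have ir: "i \<le> r" using Suc.prems(2)[of i] fi j by (cases "r < i") auto
  let ?f = "f(i := j - 1)" and ?g = "g(j := i - 1)"
  have rel: "j' \<le> ?f i' \<longleftrightarrow> i' \<le> ?g j'" if "1 \<le> i'" "1 \<le> j'" for i' j'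
    using Suc.prems(1)[OF that] Suc.prems(1)[of i j'] Suc.prems(1)[of i' j] that i j fi
    by (auto simp: i_def)
  have sum: "(\<Sum>j = 1..N - r. g j) = Suc (\<Sum>j = 1..N - r. ?g j)"
  proof -
    have "(\<Sum>j' \<in> {1..N - r} - {j}. ?g j') = (\<Sum>j' \<in> {1..N - r} - {j}. g j')"
      by (intro sum.cong) auto
    then show ?thesis
      using i j by (subst (1 2) sum.remove[of _ j]) (auto simp: i_def)
  qed
  let ?P = "grassmann_perm N r f g" and ?Q = "grassmann_perm N r ?f ?g"
  have "n = (\<Sum>j = 1..N - r. ?g j)" using sum Suc.hyps(2) by simp
  then have Q: "?Q permutes {0..<N}" "signof ?Q = ((-1) ^ n :: int)"
    using Suc.hyps(1)[of ?g ?f] rel Suc.prems(2,3) ir j by auto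
  \<comment> \<open>The permutation takes the values \<open>Suc a\<close> and \<open>a\<close> at
    the positions \<open>r - i\<close> and \<open>r + j - 1\<close> of row \<open>i\<close> and
    column \<open>j\<close>; removing the cell interchanges them.\<close>
  define a where "a = j - 1 + (r - i)"
  have aN: "Suc a < N" using i j ir assms(1) by (simp add: a_def)
  have Q1: "?Q (r - i) = a" using i ir by (simp add: grassmann_perm_def a_def)
  have Q2: "?Q (r + j - 1) = Suc a"
    using i j ir assms(1) by (auto simp: grassmann_perm_def a_def)
  have P1: "?P (r - i) = Suc a" using i j ir fi by (simp add: grassmann_perm_def a_def)
  have P2: "?P (r + j - 1) = a"
    using i j ir assms(1) by (auto simp: grassmann_perm_def a_def i_def[symmetric])
  let ?t = "Transposition.transpose a (Suc a)"
  have "?P b = ?t (?Q b)" for b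
  proof (cases "b = r - i \<or> b = r + j - 1")
    case False
    then have "?P b = ?Q b" using i j ir by (auto simp: grassmann_perm_def)
    moreover have "?Q b \<noteq> a" "?Q b \<noteq> Suc a"
      using False Q1 Q2 permutes_inj[OF Q(1)] by (metis injD)+
    ultimately show ?thesis by simp
  qed (use P1 P2 Q1 Q2 in auto)
  then have P: "?P = ?t \<circ> ?Q" by auto
  have t: "?t permutes {0..<N}" using aN by (intro permutes_swap_id) auto
  have "sign ?P = sign ?t * sign ?Q" unfolding P
    by (rule sign_compose) (use t Q(1) in \<open>auto intro: permutes_imp_permutation\<close>)
  then show ?case
    using permutes_compose[OF Q(1) t, folded P] Q(2) Suc.hyps(2)[symmetric]
    by (simp add: sign_swap_id)
qed

section \<open>Jacobi's identity for complementary minors\<close>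

lemma fdet_one: "fdet n (\<lambda>i j. if i = j then 1 else 0) = 1"
proof -
  have "mat n n (\<lambda>(i, j). if i = j then 1 else 0) = (1\<^sub>m n :: 'a mat)"
    by (intro eq_matI) auto
  then show ?thesis by (simp add: fdet_def)
qed

lemma fdet_scale: "fdet n (\<lambda>i j. x i * y j * f i j) = prod x {0..<n} * prod y {0..<n} * fdet n f"
proof -
  have "(\<Prod>i = 0..<n. x i * y (p i) * f i (p i)) =
      prod x {0..<n} * prod y {0..<n} * (\<Prod>i = 0..<n. f i (p i))" if "p permutes {0..<n}" for p
    using prod.permute[OF that, of y] by (simp add: prod.distrib comp_def)
  then show ?thesis
    unfolding fdet_eq_sum_rows sum_distrib_left by (intro sum.cong) (auto simp: mult_ac)
qed

lemma fdet_reverse: "fdet n (\<lambda>i j. f (n - 1 - i) (n - 1 - j)) = fdet n f"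
proof -
  define p where "p = (\<lambda>b. if b < n then n - 1 - b else b)"
  have p: "p permutes {0..<n}" unfolding p_def by (rule reverse_permutes)
  have "fdet n (\<lambda>i j. f (n - 1 - i) (n - 1 - j)) = fdet n (\<lambda>i j. f (p i) (p j))"
    by (intro fdet_cong) (simp add: p_def)
  also have "\<dots> = signof p * fdet n (\<lambda>i j. f i (p j))"
    by (rule fdet_permute_rows[OF p, of "\<lambda>i j. f i (p j)"])
  also have "\<dots> = (signof p * signof p) * fdet n f"
    by (simp only: fdet_permute_cols[OF p] mult.assoc)
  also have "signof p * signof p = (1 :: 'a)"
    by (cases p rule: sign_cases) auto
  finally show ?thesis by simp
qed

text \<open>Jacobi's identity yields a minor of the inverse on complementary indices, with rows and
  columns interchanged and a sign. Transposing and reversing the indices brings it back to the form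
  of \<open>S_gen\<close>, with the first rows and with columns given by a partition; the factors
  \<open>(-1) ^ (i + j)\<close> absorb the sign.\<close>

definition dual_entry :: "nat \<Rightarrow> 'a :: idom mat \<Rightarrow> nat \<Rightarrow> nat \<Rightarrow> 'a" where
  "dual_entry N W i j = (-1) ^ (i + j) * W $$ (N - 1 - j, N - 1 - i)"

text \<open>Jacobi's identity for complementary minors. In the proof, \<open>M\<close> consists of the unit vectors of the
  chosen columns followed by the last columns of \<open>W\<close>, so that \<open>U * M\<close> and a row permutation of \<open>M\<close>
  are block triangular, with blocks the minor of \<open>U\<close> and the complementary minor of \<open>W\<close>.\<close>

lemma S_gen_conjugate:
  fixes U W :: "'a :: field mat"
  assumes U: "U \<in> carrier_mat N N" "det U = 1" and W: "W \<in> carrier_mat N N" "U * W = 1\<^sub>m N"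
    and mu: "is_partition mu" and r: "r \<le> N" and fits: "length mu \<le> N - r" "part mu 1 \<le> r"
  shows "S_gen (\<lambda>i j. U $$ (i, j)) r (conjugate_partition mu) = S_gen (dual_entry N W) (N - r) mu"
proof -
  define f where "f = part (conjugate_partition mu)"
  define g where "g = part mu"
  define s where "s = N - r"
  define P where "P = grassmann_perm N r f g"
  have N: "N = r + s" using r by (simp add: s_def)
  have rel: "j \<le> f i \<longleftrightarrow> i \<le> g j" if "1 \<le> i" "1 \<le> j" for i j
    using le_part_conjugate_iff[OF mu that(2,1)] by (simp add: f_def g_def)
  have f0: "f i = 0" if "r < i" for i
    using rel[of i 1] that fits(2) by (simp add: g_def)
  have g0: "g j = 0" if "N - r < j" for j
    using that fits(1) by (simp add: g_def part_eq_0)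
  have P: "P permutes {0..<N}" "signof P = ((-1) ^ (\<Sum>j = 1..N - r. g j) :: int)"
    using grassmann_perm_sign[OF r rel f0 g0] by (simp_all add: P_def)
  have gr: "g j \<le> r" for j
    using part_antimono[OF mu, of 1 j] fits(2) by (cases "j = 0") (auto simp: g_def part_def)
  define h where "h i b = (if b < r then if i = P b then 1 else 0 else W $$ (i, b))" for i b
  let ?M = "mat N N (\<lambda>(i, b). h i b)"
  have PN: "P b < N \<longleftrightarrow> b < N" for b using permutes_in_image[OF P(1), of b] by simp
  have UM: "(U * ?M) $$ (i, b) = (if b < r then U $$ (i, P b) else if i = b then 1 else 0)"
    if ib: "i < N" "b < N" for i b
  proof (cases "b < r")
    case True
    have "(U * ?M) $$ (i, b) = (\<Sum>k = 0..<N. U $$ (i, k) * h k b)"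
      using ib U by (simp add: scalar_prod_def)
    also have "\<dots> = (\<Sum>k = 0..<N. if k = P b then U $$ (i, k) else 0)"
      using True by (intro sum.cong) (auto simp: h_def)
    finally show ?thesis using True PN[of b] ib by simp
  next
    case False
    have "(U * ?M) $$ (i, b) = (\<Sum>k = 0..<N. U $$ (i, k) * W $$ (k, b))"
      using ib U False by (simp add: scalar_prod_def h_def)
    also have "\<dots> = (U * W) $$ (i, b)" using ib U(1) W(1) by (simp add: scalar_prod_def)
    finally show ?thesis using W(2) False ib by simp
  qed
  have "fdet N h = det U * det ?M" by (simp add: fdet_def U)
  also have "\<dots> = det (U * ?M)" using U by (intro det_mult[symmetric]) auto
  also have "\<dots> = fdet N (\<lambda>i b. if b < r then U $$ (i, P b) else if i = b then 1 else 0)"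
    unfolding fdet_def using U UM by (intro arg_cong[of _ _ det] eq_matI) auto
  also have "\<dots> = fdet (r + s) (\<lambda>b i. if b < r then U $$ (i, P b) else if i = b then 1 else 0)"
    unfolding N by (rule fdet_transpose[symmetric])
  also have "\<dots> = fdet r (\<lambda>b i. if b < r then U $$ (i, P b) else if i = b then 1 else 0) *
      fdet s (\<lambda>b i. if r + b < r then U $$ (r + i, P (r + b)) else if r + i = r + b then 1 else 0)"
    by (rule fdet_block) auto
  also have "fdet r (\<lambda>b i. if b < r then U $$ (i, P b) else if i = b then 1 else 0) =
      fdet r (\<lambda>i b. if b < r then U $$ (i, P b) else if i = b then 1 else 0)"
    by (rule fdet_transpose)
  also have "\<dots> = S_gen (\<lambda>i j. U $$ (i, j)) r (conjugate_partition mu)"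
    unfolding S_gen_def by (intro fdet_cong) (simp add: P_def grassmann_perm_def f_def)
  also have "fdet s (\<lambda>b i. if r + b < r then U $$ (r + i, P (r + b)) else if r + i = r + b then 1 else 0)
      = fdet s (\<lambda>i j. if i = j then 1 else 0)"
    by (intro fdet_cong) auto
  finally have 1: "fdet N h = S_gen (\<lambda>i j. U $$ (i, j)) r (conjugate_partition mu)"
    by (simp add: fdet_one)
  have "signof P * fdet N h = fdet (r + s) (\<lambda>i b. h (P i) b)"
    unfolding N[symmetric] by (rule fdet_permute_rows[OF P(1), symmetric])
  also have "\<dots> = fdet r (\<lambda>i b. h (P i) b) * fdet s (\<lambda>i b. h (P (r + i)) (r + b))"
    using permutes_inj[OF P(1)] by (intro fdet_block) (auto simp: h_def inj_eq)
  also have "fdet r (\<lambda>i b. h (P i) b) = fdet r (\<lambda>i j. if i = j then 1 else 0)"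
    using permutes_inj[OF P(1)] by (intro fdet_cong) (auto simp: h_def inj_eq)
  also have "fdet s (\<lambda>i b. h (P (r + i)) (r + b)) = fdet s (\<lambda>i b. W $$ (r + i - g (Suc i), r + b))"
    by (intro fdet_cong) (auto simp: h_def P_def grassmann_perm_def N)
  finally have 2: "signof P * fdet N h = fdet s (\<lambda>i b. W $$ (r + i - g (Suc i), r + b))"
    by (simp add: fdet_one)
  \<comment> \<open>The factors \<open>?e\<close> occur once over the rows and once over the columns
    and cancel. What is left is -1 to the number of cells of \<open>mu\<close>, which is the sign of
    \<open>P\<close>.\<close>
  let ?e = "\<lambda>i. (-1) ^ (s - 1 - i) :: 'a"
  have "S_gen (dual_entry N W) s mu =
      fdet s (\<lambda>i b. dual_entry N W (s - 1 - i) (g (s - (s - 1 - b)) + (s - 1 - b)))"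
    unfolding S_gen_def g_def
    by (rule fdet_reverse[symmetric, of s "\<lambda>i b. dual_entry N W i (part mu (s - b) + b)"])
  also have "\<dots> = fdet s (\<lambda>i b. ?e i * ((-1) ^ g (Suc b) * ?e b) * W $$ (r + b - g (Suc b), r + i))"
  proof (rule fdet_cong)
    fix i b assume ib: "i < s" "b < s"
    have "s - (s - 1 - b) = Suc b" using ib by simp
    moreover have "N - 1 - (s - 1 - i) = r + i" using ib by (simp add: N)
    moreover have "N - 1 - (g (Suc b) + (s - 1 - b)) = r + b - g (Suc b)"
      using ib gr[of "Suc b"] by (simp add: N)
    ultimately show "dual_entry N W (s - 1 - i) (g (s - (s - 1 - b)) + (s - 1 - b)) =
        ?e i * ((-1) ^ g (Suc b) * ?e b) * W $$ (r + b - g (Suc b), r + i)"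
      by (simp only: dual_entry_def power_add mult.assoc)
  qed
  also have "\<dots> = prod ?e {0..<s} * prod (\<lambda>b. (-1) ^ g (Suc b) * ?e b) {0..<s} *
      fdet s (\<lambda>i b. W $$ (r + b - g (Suc b), r + i))"
    by (rule fdet_scale)
  also have "fdet s (\<lambda>i b. W $$ (r + b - g (Suc b), r + i)) =
      fdet s (\<lambda>i b. W $$ (r + i - g (Suc i), r + b))"
    by (rule fdet_transpose)
  also have "prod ?e {0..<s} * prod (\<lambda>b. (-1) ^ g (Suc b) * ?e b) {0..<s} =
      (\<Prod>b = 0..<s. (-1) ^ g (Suc b) * (?e b * ?e b))"
    by (simp only: prod.distrib mult_ac)
  also have "\<dots> = (\<Prod>b = 0..<s. (-1) ^ g (Suc b))"
    by (intro prod.cong) (auto simp flip: power_mult_distrib)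
  also have "\<dots> = (-1) ^ (\<Sum>j = 1..s. g j)"
    unfolding power_sum by (rule prod.reindex_bij_witness[of _ "\<lambda>j. j - 1" Suc]) auto
  also have "(-1) ^ (\<Sum>j = 1..s. g j) = (signof P :: 'a)"
  proof -
    have "(signof P :: 'a) = of_int (signof P :: int)" by simp
    also have "\<dots> = (-1) ^ (\<Sum>j = 1..s. g j)" unfolding P(2) s_def by simp
    finally show ?thesis ..
  qed
  finally have "S_gen (dual_entry N W) s mu = (signof P * signof P) * fdet N h"
    unfolding 2[symmetric] by (simp only: mult.assoc)
  also have "signof P * signof P = (1 :: 'a)" by (cases P rule: sign_cases) auto
  finally show ?thesis using 1 by (simp add: s_def)
qed

lemma S_minor_eq: "S_minor N r lam = S_gen (\<lambda>i j. X_plus N $$ (i, j)) r lam"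
  by (simp add: S_minor_def S_gen_def fdet_def)

section \<open>Corners and sizes under conjugation, and the two identities for
  \<open>X_plus\<close>\<close>

lemma length_conjugate:
  assumes "is_partition lam"
  shows "length (conjugate_partition lam) = part lam 1"
proof -
  have "j \<le> length (conjugate_partition lam) \<longleftrightarrow> j \<le> part lam 1" if "1 \<le> j" for j
    using part_pos_iff[OF is_partition_conjugate[OF assms], of j]
      le_part_conjugate_iff[OF assms, of 1 j] that by auto
  from this[of "part lam 1"] this[of "length (conjugate_partition lam)"] show ?thesis
    by (cases "part lam 1"; cases "length (conjugate_partition lam)") auto
qed

lemma part_conjugate_1:
  assumes "is_partition lam"
  shows "part (conjugate_partition lam) 1 = length lam"
  using length_conjugate[OF is_partition_conjugate[OF assms]] conjugate_conjugate[OF assms] by simp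

lemma diagram_conjugate:
  assumes "is_partition lam"
  shows "(j, i) \<in> diagram (conjugate_partition lam) \<longleftrightarrow> (i, j) \<in> diagram lam"
  using le_part_conjugate_iff[OF assms, of i j] by (auto simp: diagram_iff)

lemma card_corners_conjugate:
  assumes "is_partition lam"
  shows "card (corners (conjugate_partition lam)) = card (corners lam)"
proof -
  have "corners (conjugate_partition lam) = prod.swap ` corners lam"
    by (auto simp: corners_def diagram_conjugate[OF assms] image_iff)
  then show ?thesis by (simp add: card_image)
qed

text \<open>A corner row of the conjugate is a corner column of \<open>lam\<close>, hence one of its
  distinct parts. So the \<open>d\<close>-th shortest row length of \<open>lam\<close> is the
  \<open>d\<close>-th corner row of the conjugate.\<close>

lemma corner_rows_conjugate:
  assumes "is_partition lam"
  shows "corner_rows (conjugate_partition lam) = set lam"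
proof -
  note le = le_part_conjugate_iff[OF assms]
  have set: "x \<in> set lam \<longleftrightarrow> 1 \<le> x \<and> (\<exists>i\<ge>1. part lam i = x)" for x
  proof
    assume x: "x \<in> set lam"
    then obtain k where "k < length lam" "lam ! k = x" by (auto simp: in_set_conv_nth)
    then have "part lam (Suc k) = x" by (simp add: part_def)
    moreover have "x \<noteq> 0" using assms x by (metis is_partition_def)
    ultimately show "1 \<le> x \<and> (\<exists>i\<ge>1. part lam i = x)" by (intro conjI exI[of _ "Suc k"]) auto
  next
    assume "1 \<le> x \<and> (\<exists>i\<ge>1. part lam i = x)"
    then show "x \<in> set lam" by (auto simp: part_def split: if_splits intro!: nth_mem)
  qed
  have "x \<in> corner_rows (conjugate_partition lam) \<longleftrightarrow> x \<in> set lam" for x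
  proof
    assume x: "x \<in> corner_rows (conjugate_partition lam)"
    let ?i = "part (conjugate_partition lam) x"
    from x have "1 \<le> x" "\<not> ?i \<le> part (conjugate_partition lam) (Suc x)" "1 \<le> ?i"
      by (auto simp: corner_rows_def)
    then have "part lam ?i = x" using le[of ?i x] le[of ?i "Suc x"] by auto
    with \<open>1 \<le> x\<close> \<open>1 \<le> ?i\<close> show "x \<in> set lam" unfolding set by blast
  next
    assume "x \<in> set lam"
    then obtain i where "1 \<le> x" "1 \<le> i" "part lam i = x" unfolding set by blast
    then show "x \<in> corner_rows (conjugate_partition lam)"
      using le[of i x] le[of i "Suc x"] by (auto simp: corner_rows_def)
  qed
  then show ?thesis by blast
qed

text \<open>These are the size conditions under which \<open>S_gen_conjugate\<close> can be applied
  to each term. Strips are added from row 2 on and reach at most one row below the diagram, so the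
  first part is kept and the length grows by at most 1.\<close>

lemma add_list_rem_list_bounds:
  assumes lam: "is_partition lam" and d: "1 \<le> d" "d \<le> card (corners lam)"
    and pq: "(ps, qs) \<in> nested_indices (card (corners lam)) d t"
  shows "is_partition (add_list lam ps qs lam)"
    and "length (add_list lam ps qs lam) \<le> Suc (length lam)"
    and "part (add_list lam ps qs lam) 1 = part lam 1"
    and "is_partition (rem_list lam ps qs lam)"
    and "length (rem_list lam ps qs lam) \<le> length lam"
    and "part (rem_list lam ps qs lam) 1 \<le> part lam 1"
proof -
  let ?xs = "strip_ends lam ps qs"
  have sub: "set ps \<subseteq> {1..card (corners lam)}" "set qs \<subseteq> {1..card (corners lam)}"
    using pq d by (auto simp: nested_indices_def)
  note nested = nested_pairs_strip_ends[OF d pq]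
  have bounds: "\<forall>(a, b) \<in> set ?xs. 0 < a \<and> b < Suc (length lam)"
    using nested corner_rows_bounds[of _ lam] by (fastforce simp: nested_pairs_def)
  note A = add_strips_part[OF lam nested bounds, folded add_list_eq[OF lam sub]]
  note R = rem_strips_part[OF lam nested bounds, folded rem_list_eq[OF lam sub]]
  show "is_partition (add_list lam ps qs lam)" "part (add_list lam ps qs lam) 1 = part lam 1"
    using A(1) A(2)[of 1] by auto
  have "part (add_list lam ps qs lam) (Suc (Suc (length lam))) = 0"
    using A(2)[of "Suc (Suc (length lam))"] by (simp add: part_eq_0)
  then show "length (add_list lam ps qs lam) \<le> Suc (length lam)"
    using part_pos_iff[OF A(1), of "Suc (Suc (length lam))"] by simp
  show "is_partition (rem_list lam ps qs lam)" "part (rem_list lam ps qs lam) 1 \<le> part lam 1"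
    using R(1) R(3)[of 1] by auto
  have "part (rem_list lam ps qs lam) (Suc (length lam)) = 0"
    using R(3)[of "Suc (length lam)"] by (simp add: part_eq_0)
  then show "length (rem_list lam ps qs lam) \<le> length lam"
    using part_pos_iff[OF R(1), of "Suc (length lam)"] by simp
qed

theorem theorem4p3:
  fixes N n d :: nat and lam :: "nat list"
  assumes "0 < N"
    and "is_partition lam"
    and "n = card (corners lam)"
    and "1 \<le> d" and "d \<le> n"
  shows
    "(\<forall>r l. 1 \<le> r \<and> fits N r lam \<and> fits N (r - 1) lam \<and> l = corner_row lam d \<longrightarrow>
       S_minor N r lam * S_minor N (r - 1) lam =
       S_minor N r (sub_first 1 l lam) * S_minor N (r - 1) (add_first 1 l lam) +
       (\<Sum>t = 1..min d (n - d + 1). (-1) ^ (t - 1) *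
          (\<Sum>(ps, qs) \<in> nested_indices n d t.
             S_minor N r (add_list lam ps qs lam) *
             S_minor N (r - 1) (rem_list lam ps qs lam))))
     \<and>
     (\<forall>r l lam'. fits N r lam \<and> fits N (r + 1) lam \<and>
        l = sorted_list_of_set (set lam) ! (d - 1) \<and> lam' = conjugate_partition lam \<longrightarrow>
       S_minor N r lam * S_minor N (r + 1) lam =
       S_minor N r (conjugate_partition (sub_first 1 l lam')) *
         S_minor N (r + 1) (conjugate_partition (add_first 1 l lam')) +
       (\<Sum>t = 1..min d (n - d + 1). (-1) ^ (t - 1) *
          (\<Sum>(ps, qs) \<in> nested_indices n d t.
             S_minor N r (conjugate_partition (add_list lam' ps qs lam')) *
             S_minor N (r + 1) (conjugate_partition (rem_list lam' ps qs lam')))))"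
proof (intro conjI allI impI)
  fix r l
  assume "1 \<le> r \<and> fits N r lam \<and> fits N (r - 1) lam \<and> l = corner_row lam d"
  \<comment> \<open>The strict bound on the length is the condition that \<open>lam\<close> also
    fits size \<open>r - 1\<close>.\<close>
  then have l: "l = corner_row lam d" and "length lam < r" by (auto simp: fits_def)
  then show "S_minor N r lam * S_minor N (r - 1) lam =
       S_minor N r (sub_first 1 l lam) * S_minor N (r - 1) (add_first 1 l lam) +
       (\<Sum>t = 1..min d (n - d + 1). (-1) ^ (t - 1) *
          (\<Sum>(ps, qs) \<in> nested_indices n d t.
             S_minor N r (add_list lam ps qs lam) *
             S_minor N (r - 1) (rem_list lam ps qs lam)))"
    unfolding S_minor_eq l by (intro S_gen_identity assms)
next
  fix r l lam'
  assume "fits N r lam \<and> fits N (r + 1) lam \<and>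
    l = sorted_list_of_set (set lam) ! (d - 1) \<and> lam' = conjugate_partition lam"
  then have rN: "r + 1 \<le> N" and fit: "length lam \<le> r" "part lam 1 \<le> N - (r + 1)"
    and l: "l = sorted_list_of_set (set lam) ! (d - 1)" and lam': "lam' = conjugate_partition lam"
    by (auto simp: fits_def)
  have part': "is_partition lam'" and conj': "conjugate_partition lam' = lam"
    and n': "n = card (corners lam')"
    and len': "length lam' = part lam 1" and first': "part lam' 1 = length lam"
    unfolding lam' using assms(2,3)
    by (simp_all add: is_partition_conjugate conjugate_conjugate card_corners_conjugate
        length_conjugate part_conjugate_1[unfolded One_nat_def])
  have l': "l = corner_row lam' d"
    unfolding l corner_row_def fst_corners lam' corner_rows_conjugate[OF assms(2)] ..
  have lc: "l \<in> corner_rows lam'"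
    unfolding l' using assms(4,5) n' by (intro corner_row_in) auto
  let ?U = "X_plus N"
  note U = X_plus_unitriangular[of N]
  have det: "det ?U = 1" by (rule det_upper_unitriangular[OF U])
  then obtain W where W: "W \<in> carrier_mat N N" "?U * W = 1\<^sub>m N"
    using obtain_inverse_mat[OF U(1)] by auto
  let ?V = "dual_entry N W"
  have dual: "S_minor N r (conjugate_partition mu) = S_gen ?V (N - r) mu"
    if "is_partition mu" "length mu \<le> N - r" "part mu 1 \<le> r" for mu
    unfolding S_minor_eq using rN that by (intro S_gen_conjugate[OF U(1) det W]) auto
  have dual1: "S_minor N (r + 1) (conjugate_partition mu) = S_gen ?V (N - r - 1) mu"
    if "is_partition mu" "length mu \<le> N - r - 1" "part mu 1 \<le> r + 1" for mu
    unfolding S_minor_eq using rN that S_gen_conjugate[OF U(1) det W, of mu "r + 1"] by simp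
  \<comment> \<open>The first identity will be used with \<open>N - r\<close> in place of
    \<open>r\<close>; its strict bound on the length comes from \<open>lam\<close> fitting size
    \<open>r + 1\<close>.\<close>
  have len: "length lam' < N - r" using fit(2) len' rN by simp
  note lb = corner_rows_bounds[OF lc]
  have "length (sub_first 1 l lam') \<le> length lam'"
    unfolding sub_first_def using length_filter_le[of "\<lambda>x. 0 < x"] lb(2)
    by (metis (no_types, lifting) append_take_drop_id length_append length_map)
  then have sub: "S_minor N r (conjugate_partition (sub_first 1 l lam')) =
      S_gen ?V (N - r) (sub_first 1 l lam')"
    using is_partition_sub_first[OF part' lb] part_sub_first[OF part' lb, of 1] len first' fit(1)
    by (intro dual) auto
  have "length (add_first 1 l lam') = length lam'"
    by (simp add: add_first_def)
  then have add: "S_minor N (r + 1) (conjugate_partition (add_first 1 l lam')) =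
      S_gen ?V (N - r - 1) (add_first 1 l lam')"
    using is_partition_add_first[OF part' lb(2)] part_add_first[OF part' lb(2), of 1] len first' fit(1)
    by (intro dual1) auto
  have strips: "S_minor N r (conjugate_partition (add_list lam' ps qs lam')) *
      S_minor N (r + 1) (conjugate_partition (rem_list lam' ps qs lam')) =
      S_gen ?V (N - r) (add_list lam' ps qs lam') * S_gen ?V (N - r - 1) (rem_list lam' ps qs lam')"
    if pq: "(ps, qs) \<in> nested_indices n d t" for ps qs t
  proof -
    note b = add_list_rem_list_bounds[OF part' assms(4) assms(5)[unfolded n'] pq[unfolded n']]
    show ?thesis
      using b len first' fit(1) by (subst dual, (simp; fail)+, subst dual1) auto
  qed
  have "S_minor N r lam * S_minor N (r + 1) lam =
      S_gen ?V (N - r) lam' * S_gen ?V (N - r - 1) lam'"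
    using dual[of lam'] dual1[of lam'] part' len first' fit(1) conj' by simp
  also have "\<dots> = S_gen ?V (N - r) (sub_first 1 l lam') * S_gen ?V (N - r - 1) (add_first 1 l lam') +
      (\<Sum>t = 1..min d (n - d + 1). (-1) ^ (t - 1) * (\<Sum>(ps, qs) \<in> nested_indices n d t.
         S_gen ?V (N - r) (add_list lam' ps qs lam') * S_gen ?V (N - r - 1) (rem_list lam' ps qs lam')))"
    unfolding l' by (rule S_gen_identity[OF part' len n' assms(4,5)])
  also have "(\<Sum>t = 1..min d (n - d + 1). (-1) ^ (t - 1) * (\<Sum>(ps, qs) \<in> nested_indices n d t.
         S_gen ?V (N - r) (add_list lam' ps qs lam') * S_gen ?V (N - r - 1) (rem_list lam' ps qs lam'))) =
      (\<Sum>t = 1..min d (n - d + 1). (-1) ^ (t - 1) * (\<Sum>(ps, qs) \<in> nested_indices n d t.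
         S_minor N r (conjugate_partition (add_list lam' ps qs lam')) *
         S_minor N (r + 1) (conjugate_partition (rem_list lam' ps qs lam'))))"
  proof (intro sum.cong refl arg_cong2[of _ _ _ _ "(*)"])
    fix t x assume "x \<in> nested_indices n d t"
    then show "(case x of (ps, qs) \<Rightarrow>
        S_gen ?V (N - r) (add_list lam' ps qs lam') * S_gen ?V (N - r - 1) (rem_list lam' ps qs lam')) =
      (case x of (ps, qs) \<Rightarrow> S_minor N r (conjugate_partition (add_list lam' ps qs lam')) *
        S_minor N (r + 1) (conjugate_partition (rem_list lam' ps qs lam')))"
      by (cases x) (simp only: prod.case strips)
  qed
  finally show "S_minor N r lam * S_minor N (r + 1) lam =
       S_minor N r (conjugate_partition (sub_first 1 l lam')) *
         S_minor N (r + 1) (conjugate_partition (add_first 1 l lam')) +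
       (\<Sum>t = 1..min d (n - d + 1). (-1) ^ (t - 1) *
          (\<Sum>(ps, qs) \<in> nested_indices n d t.
             S_minor N r (conjugate_partition (add_list lam' ps qs lam')) *
             S_minor N (r + 1) (conjugate_partition (rem_list lam' ps qs lam'))))"
    by (simp only: sub add)
qed

end
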